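(* Let $s_2 \ge s_1 \ge 2$ be integers, $s := s_1+s_2$, and let $\mathbb{B}$ be an $s_1$ by $s_2$ bipartite graph. Then there is $n_0$ such that for every $n \ge n_0$, $$\mathrm{ex}(n,(t+1)\mathbb{B}) \le \binom{s(t+1)-1}{2} + \mathrm{ex}\left(n-s(t+1)+1,\mathbb{B}\right) + s_1 s n$$ holds for all integers $t$ satisfying $$\frac{n}{s} - \frac{n}{65 s_1 s^2} \le t \le \frac{n}{s}.$$
   Context: An $s_1$ by $s_2$ bipartite graph is a graph whose vertex set is partitioned into $W_1,W_2$ with $|W_1|=s_1$, $|W_2|=s_2$ and every edge joining $W_1$ and $W_2$. $\mathrm{ex}(n,F)$ is the maximum number of edges in an $n$-vertex graph with no copy of $F$, and $\mathrm{ex}(n,(t+1)F)$ is the maximum number of edges in an $n$-vertex graph not containing $t+1$ pairwise vertex-disjoint copies of $F$. *)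

theory Defs
  imports Complex_Main
begin

definition simple_graph :: "'a set \<Rightarrow> 'a set set \<Rightarrow> bool" where
  "simple_graph V E \<longleftrightarrow> (\<forall>e\<in>E. e \<subseteq> V \<and> card e = 2)"

definition embeds :: "('b \<Rightarrow> 'a) \<Rightarrow> 'b set \<Rightarrow> 'b set set \<Rightarrow> 'a set \<Rightarrow> 'a set set \<Rightarrow> bool" where
  "embeds f VF EF VG EG \<longleftrightarrow> inj_on f VF \<and> f ` VF \<subseteq> VG \<and> (\<forall>e\<in>EF. f ` e \<in> EG)"

definition has_disjoint_copies :: "nat \<Rightarrow> 'b set \<Rightarrow> 'b set set \<Rightarrow> 'a set \<Rightarrow> 'a set set \<Rightarrow> bool" where
  "has_disjoint_copies k VF EF VG EG \<longleftrightarrow>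
     (\<exists>fs :: nat \<Rightarrow> 'b \<Rightarrow> 'a.
        (\<forall>i<k. embeds (fs i) VF EF VG EG) \<and>
        (\<forall>i<k. \<forall>j<k. i \<noteq> j \<longrightarrow> fs i ` VF \<inter> fs j ` VF = {}))"

text \<open>ex(n, kF): maximum number of edges of an n-vertex graph (vertex set {0..<n})
  with no k pairwise vertex-disjoint copies of F. (Sup of the empty set of naturals is 0.)\<close>
definition ex_copies :: "nat \<Rightarrow> nat \<Rightarrow> 'b set \<Rightarrow> 'b set set \<Rightarrow> nat" where
  "ex_copies n k VF EF = Sup {card E | E :: nat set set.
      simple_graph {0..<n} E \<and> \<not> has_disjoint_copies k VF EF {0..<n} E}"

definition ex :: "nat \<Rightarrow> 'b set \<Rightarrow> 'b set set \<Rightarrow> nat" where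
  "ex n VF EF = ex_copies n 1 VF EF"

definition bipartite_graph :: "nat \<Rightarrow> nat \<Rightarrow> 'b set \<Rightarrow> 'b set \<Rightarrow> 'b set set \<Rightarrow> bool" where
  "bipartite_graph s1 s2 W1 W2 E \<longleftrightarrow>
     finite W1 \<and> finite W2 \<and> W1 \<inter> W2 = {} \<and> card W1 = s1 \<and> card W2 = s2 \<and>
     E \<subseteq> {{u, v} | u v. u \<in> W1 \<and> v \<in> W2}"

end

theory Submission
  imports Defs "HOL-Library.Disjoint_Sets"
begin

text \<open>
  Put \<open>s = s1 + s2\<close> and \<open>m = n - s (t + 1) + 1\<close>, so that \<open>65 s1 s m \<le> n\<close>. A graph violating the
  bound has fewer than \<open>m n\<close> non-edges. Hence all but \<open>O(n / s)\<close> vertices are non-adjacent to at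
  most \<open>n / (4 s1)\<close> vertices; let \<open>L\<close> be the set of the exceptional ones. Take a maximal family of
  disjoint stars with centre in \<open>L\<close> and \<open>s1\<close> leaves outside \<open>L\<close>, then a maximal family of disjoint
  copies of the bipartite graph among the unused vertices of \<open>L\<close>, and let \<open>U\<close> be what remains of
  \<open>L\<close>. Outside \<open>L\<close> the graph is so dense that the stars extend to disjoint copies and all but fewer
  than \<open>s\<close> of the other vertices can be tiled; as there are at most \<open>t\<close> disjoint copies,
  \<open>m \<le> |U|\<close>.

  By maximality \<open>U\<close> contains no copy and each of its vertices has fewer than \<open>s1\<close> neighbours that
  lie outside \<open>L\<close> and are not leaves. The edges from \<open>U\<close> to the leaves and to \<open>L - U\<close> are outweighed
  by the many non-edges at the vertices of \<open>L - U\<close>, so that the graph has at most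
  \<open>ex(|U|) + (n - |U| choose 2) + s1 |U|\<close> edges. Finally \<open>ex(u) + (n - u choose 2)\<close> decreases in
  \<open>u \<le> n / 2\<close>.
\<close>

subsection \<open>Disjoint representatives and matchings\<close>

lemma disjoint_subsets_greedy:
  assumes "finite I" and "\<And>i. i \<in> I \<Longrightarrow> finite (N i)"
    and "\<And>i. i \<in> I \<Longrightarrow> k * card I \<le> card (N i)"
  shows "\<exists>B. (\<forall>i\<in>I. B i \<subseteq> N i \<and> card (B i) = k) \<and> disjoint_family_on B I"
  using assms
proof (induction I rule: finite_induct)
  case empty
  then show ?case by (simp add: disjoint_family_on_def)
next
  case (insert j I)
  have "\<exists>B. (\<forall>i\<in>I. B i \<subseteq> N i \<and> card (B i) = k) \<and> disjoint_family_on B I"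
  proof (rule insert.IH)
    show "finite (N i)" if "i \<in> I" for i using insert.prems that by simp
    show "k * card I \<le> card (N i)" if "i \<in> I" for i
      using insert.prems(2)[of i] insert.hyps that by simp
  qed
  then obtain B where B: "\<forall>i\<in>I. B i \<subseteq> N i \<and> card (B i) = k" "disjoint_family_on B I"
    by blast
  have finB: "finite (B i)" if "i \<in> I" for i
    using B(1) that insert.prems(1)[of i] by (meson finite_subset insertI2)
  have "card (\<Union>i\<in>I. B i) \<le> (\<Sum>i\<in>I. card (B i))"
    using insert.hyps(1) by (rule card_UN_le)
  also have "\<dots> = k * card I" using B(1) by simp
  finally have "card (N j - (\<Union>i\<in>I. B i)) \<ge> k"
    using insert.prems(2)[of j] insert.hyps diff_card_le_card_Diff[of "\<Union>i\<in>I. B i" "N j"] finB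
    by (simp add: algebra_simps)
  then obtain C where C: "C \<subseteq> N j - (\<Union>i\<in>I. B i)" "card C = k"
    by (meson obtain_subset_with_card_n)
  have "disjoint_family_on (B(j := C)) (insert j I)"
    using B(2) C(1) insert.hyps(2) unfolding disjoint_family_on_def by (auto; blast)
  moreover have "\<forall>i\<in>insert j I. (B(j := C)) i \<subseteq> N i \<and> card ((B(j := C)) i) = k"
    using B(1) C by auto
  ultimately show ?case by blast
qed

text \<open>Among all bijections take one with the fewest bad pairs. A bad \<open>x\<close> can
  exchange its image with some \<open>z\<close> so that both new pairs are related, because at most
  \<open>d1 + d2 < card X\<close> choices of \<open>z\<close> fail; the exchange removes a bad pair
  and creates none.\<close>

lemma perfect_matching_dense:
  assumes fin: "finite X" "finite Y" and card: "card X = card Y"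
    and dX: "\<And>x. x \<in> X \<Longrightarrow> card {y\<in>Y. \<not> R x y} \<le> d1"
    and dY: "\<And>y. y \<in> Y \<Longrightarrow> card {x\<in>X. \<not> R x y} \<le> d2"
    and less: "d1 + d2 < card X"
  shows "\<exists>p. bij_betw p X Y \<and> (\<forall>x\<in>X. R x (p x))"
proof -
  define bad where "bad p = {x\<in>X. \<not> R x (p x)}" for p
  obtain p0 where "bij_betw p0 X Y" using finite_same_card_bij[OF fin card] by blast
  then obtain p where p: "bij_betw p X Y"
    and min: "\<And>q. bij_betw q X Y \<Longrightarrow> card (bad p) \<le> card (bad q)"
    using ex_has_least_nat[of "\<lambda>p. bij_betw p X Y" p0 "\<lambda>p. card (bad p)"] by blast
  have "bad p = {}"
  proof (rule ccontr)
    assume "bad p \<noteq> {}"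
    then obtain x where x: "x \<in> X" "\<not> R x (p x)" by (auto simp: bad_def)
    have px: "p x \<in> Y" using p x by (auto simp: bij_betw_def)
    \<comment> \<open>The obstacles to an exchange: \<open>?S\<close> holds the \<open>z\<close>
      whose image does not suit \<open>x\<close>, \<open>?T\<close> the \<open>z\<close> that cannot
      take over \<open>p x\<close>.\<close>
    let ?S = "{z\<in>X. \<not> R x (p z)}" and ?T = "{z\<in>X. \<not> R z (p x)}"
    have "card ?S = card (p ` ?S)"
      using p by (intro card_image[symmetric]) (auto simp: bij_betw_def inj_on_def)
    also have "\<dots> \<le> card {y\<in>Y. \<not> R x y}"
      using p fin by (intro card_mono) (auto simp: bij_betw_def)
    finally have "card ?S \<le> d1" using dX[OF x(1)] by simp
    moreover have "card (?S \<union> ?T) \<le> card ?S + card ?T" by (rule card_Un_le)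
    ultimately have "card (?S \<union> ?T) < card X" using dY[OF px] less by linarith
    then have "\<not> X \<subseteq> ?S \<union> ?T"
      using card_mono[of "?S \<union> ?T" X] fin by auto
    then obtain z where z: "z \<in> X" "R x (p z)" "R z (p x)" by blast
    define q where "q = p(x := p z, z := p x)"
    have "bij_betw q X Y"
      using p x(1) z(1) unfolding q_def bij_betw_def inj_on_def by (auto simp: image_iff) 
    moreover have "bad q \<subset> bad p"
      using x z unfolding bad_def q_def by auto
    then have "card (bad q) < card (bad p)"
      using fin by (intro psubset_card_mono) (auto simp: bad_def)
    ultimately show False using min[of q] by simp
  qed
  then show ?thesis using p by (auto simp: bad_def)
qed

subsection \<open>Vertex sets tiled by copies\<close>

text \<open>Only the covered vertex set is recorded, not the copies, so that tilings of disjoint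
  sets combine by plain union. The copies may map into \<open>UNIV\<close>, since the covered set
  itself says where they lie.\<close>

inductive tileable :: "'b set \<Rightarrow> 'b set set \<Rightarrow> 'a set set \<Rightarrow> 'a set \<Rightarrow> bool" for VF EF E where
  tileable_empty: "tileable VF EF E {}"
| tileable_copy: "tileable VF EF E X \<Longrightarrow> embeds f VF EF UNIV E \<Longrightarrow> f ` VF \<inter> X = {}
    \<Longrightarrow> tileable VF EF E (f ` VF \<union> X)"

lemma tileable_Un:
  assumes "tileable VF EF E X" "tileable VF EF E Y" "X \<inter> Y = {}"
  shows "tileable VF EF E (X \<union> Y)"
  using assms
proof (induction rule: tileable.induct)
  case tileable_empty
  then show ?case by simp
next
  case (tileable_copy X f)
  then have "tileable VF EF E (f ` VF \<union> (X \<union> Y))"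
    by (intro tileable.tileable_copy) auto
  then show ?case by (simp add: Un_assoc)
qed

lemma tileable_UN:
  assumes "finite I" "\<And>i. i \<in> I \<Longrightarrow> tileable VF EF E (T i)" "disjoint_family_on T I"
  shows "tileable VF EF E (\<Union>i\<in>I. T i)"
  using assms
proof (induction I rule: finite_induct)
  case empty
  then show ?case by (simp add: tileable_empty)
next
  case (insert j I)
  have "disjoint_family_on T I" "T j \<inter> (\<Union>i\<in>I. T i) = {}"
    using insert.prems(2) insert.hyps by (auto simp: disjoint_family_on_def)
  then show ?case using insert by (simp add: tileable_Un)
qed

lemma tileable_finite: "tileable VF EF E X \<Longrightarrow> finite VF \<Longrightarrow> finite X"
  by (induction rule: tileable.induct) auto

text \<open>Returns from covered sets to indexed families of copies: in each inductive step the new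
  copy receives the next free index \<open>k\<close>.\<close>

lemma tileable_has_disjoint_copies:
  assumes "tileable VF EF E X" "finite VF"
  shows "\<exists>k. card X = k * card VF \<and> has_disjoint_copies k VF EF X E"
  using assms
proof (induction rule: tileable.induct)
  case tileable_empty
  show ?case by (intro exI[of _ 0]) (simp add: has_disjoint_copies_def)
next
  case (tileable_copy X f)
  then obtain k where k: "card X = k * card VF" and "has_disjoint_copies k VF EF X E"
    by blast
  from this(2) obtain fs where fs: "\<forall>i<k. embeds (fs i) VF EF X E"
      "\<forall>i<k. \<forall>j<k. i \<noteq> j \<longrightarrow> fs i ` VF \<inter> fs j ` VF = {}"
    unfolding has_disjoint_copies_def by (elim exE conjE)
  have "card (f ` VF) = card VF"
    using tileable_copy.hyps(2) by (simp add: embeds_def card_image)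
  then have "card (f ` VF \<union> X) = Suc k * card VF"
    using k tileable_copy.hyps(3) tileable_copy.prems tileable_finite[OF tileable_copy.hyps(1)]
    by (simp add: card_Un_disjoint)
  moreover have "has_disjoint_copies (Suc k) VF EF (f ` VF \<union> X) E"
    unfolding has_disjoint_copies_def
  proof (intro exI[of _ "fs(k := f)"] conjI allI impI)
    fix i assume "i < Suc k"
    then show "embeds ((fs(k := f)) i) VF EF (f ` VF \<union> X) E"
      using fs(1) tileable_copy.hyps(2) by (cases "i = k") (simp_all add: embeds_def le_supI2)
  next
    fix i j assume ij: "i < Suc k" "j < Suc k" "i \<noteq> j"
    have X: "f ` VF \<inter> fs i ` VF = {}" if "i < k" for i
      using fs(1) that tileable_copy.hyps(3) by (fastforce simp: embeds_def)
    show "(fs(k := f)) i ` VF \<inter> (fs(k := f)) j ` VF = {}"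
      using ij fs(2) X[of i] X[of j]
      by (cases "i = k"; cases "j = k") (simp_all add: Int_commute)
  qed
  ultimately show ?case by blast
qed

lemma has_disjoint_copies_mono:
  assumes "has_disjoint_copies k VF EF X E" "X \<subseteq> V" "l \<le> k"
  shows "has_disjoint_copies l VF EF V E"
proof -
  obtain fs where fs: "\<forall>i<k. embeds (fs i) VF EF X E"
      "\<forall>i<k. \<forall>j<k. i \<noteq> j \<longrightarrow> fs i ` VF \<inter> fs j ` VF = {}"
    using assms(1) unfolding has_disjoint_copies_def by (elim exE conjE)
  have "embeds (fs i) VF EF V E" if "i < l" for i
    using fs(1) that assms(2,3) unfolding embeds_def by (meson order_less_le_trans subset_trans)
  moreover have "\<forall>i<l. \<forall>j<l. i \<noteq> j \<longrightarrow> fs i ` VF \<inter> fs j ` VF = {}"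
    using fs(2) assms(3) by simp
  ultimately show ?thesis unfolding has_disjoint_copies_def by (intro exI[of _ fs]) simp
qed

lemma has_disjoint_copies_1_iff:
  "has_disjoint_copies 1 VF EF V E \<longleftrightarrow> (\<exists>f. embeds f VF EF V E)"
proof
  assume "\<exists>f. embeds f VF EF V E"
  then obtain f where "embeds f VF EF V E" by blast
  then show "has_disjoint_copies 1 VF EF V E"
    unfolding has_disjoint_copies_def by (intro exI[of _ "\<lambda>_. f"]) simp
next
  assume "has_disjoint_copies 1 VF EF V E"
  then obtain fs where "\<forall>i<(1::nat). embeds (fs i) VF EF V E"
    unfolding has_disjoint_copies_def by (elim exE conjE)
  then show "\<exists>f. embeds f VF EF V E" by auto
qed

lemma tileable_single:
  assumes "embeds f VF EF V E"
  shows "tileable VF EF E (f ` VF)"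
  using tileable_copy[OF tileable_empty, of f VF EF E] assms by (simp add: embeds_def)

text \<open>Any two bijections \<open>W1\<close> to \<open>A\<close> and \<open>W2\<close> to
  \<open>B\<close> together embed the bipartite graph, because all edges between \<open>A\<close>
  and \<open>B\<close> are present.\<close>

lemma tileable_complete_bipartite:
  assumes "bipartite_graph s1 s2 W1 W2 EB" "finite A" "finite B" "card A = s1" "card B = s2"
    and "A \<inter> B = {}" and "\<And>a b. a \<in> A \<Longrightarrow> b \<in> B \<Longrightarrow> {a, b} \<in> E"
  shows "tileable (W1 \<union> W2) EB E (A \<union> B)"
proof -
  have W: "finite W1" "finite W2" "W1 \<inter> W2 = {}" "card W1 = s1" "card W2 = s2"
    "EB \<subseteq> {{u, v} | u v. u \<in> W1 \<and> v \<in> W2}"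
    using assms(1) by (auto simp: bipartite_graph_def)
  obtain g where g: "bij_betw g W1 A" using finite_same_card_bij[of W1 A] W assms by auto
  obtain h where h: "bij_betw h W2 B" using finite_same_card_bij[of W2 B] W assms by auto
  define f where "f w = (if w \<in> W1 then g w else h w)" for w
  have "bij_betw f W1 A" using g by (simp add: f_def cong: bij_betw_cong)
  moreover have fh: "f w = h w" if "w \<in> W2" for w using that W(3) by (auto simp: f_def)
  then have "bij_betw f W2 B" using h by (simp cong: bij_betw_cong)
  ultimately have f: "bij_betw f (W1 \<union> W2) (A \<union> B)"
    using assms(6) by (rule bij_betw_combine)
  have "f ` e \<in> E" if e: "e \<in> EB" for e
  proof -
    obtain u v where uv: "e = {u, v}" "u \<in> W1" "v \<in> W2" using subsetD[OF W(6) e] by blast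
    have "f u \<in> A" using g uv by (auto simp: f_def bij_betw_def)
    moreover have "f v \<in> B" using h uv fh by (auto simp: bij_betw_def)
    ultimately show ?thesis using assms(7) uv by simp
  qed
  then have "embeds f (W1 \<union> W2) EB UNIV E" using f by (simp add: embeds_def bij_betw_def)
  from tileable_single[OF this] show ?thesis using f by (simp add: bij_betw_def)
qed

subsection \<open>Degrees and non-neighbours\<close>

lemma finite_simple_graph: "finite V \<Longrightarrow> simple_graph V E \<Longrightarrow> finite E"
  by (rule finite_subset[of _ "Pow V"]) (auto simp: simple_graph_def)

text \<open>Double counting of ordered adjacent pairs: each edge is the image of exactly two of
  them.\<close>

lemma sum_degrees:
  assumes "finite V" "simple_graph V E"
  shows "(\<Sum>v\<in>V. card {w\<in>V. {v, w} \<in> E}) = 2 * card E"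
proof -
  have finE: "finite E" using assms by (rule finite_simple_graph)
  have "card {p \<in> V \<times> V. {fst p, snd p} = e} = 2" if e: "e \<in> E" for e
  proof -
    obtain x y where xy: "e = {x, y}" "x \<noteq> y"
      using e assms(2) by (auto simp: simple_graph_def card_2_iff)
    then have "{p \<in> V \<times> V. {fst p, snd p} = e} = {(x, y), (y, x)}"
      using e assms(2) by (auto simp: simple_graph_def doubleton_eq_iff)
    then show ?thesis using xy by simp
  qed
  then have "2 * card E = (\<Sum>e\<in>E. card {p \<in> V \<times> V. {fst p, snd p} = e})" by simp
  also have "\<dots> = card (\<Union>e\<in>E. {p \<in> V \<times> V. {fst p, snd p} = e})"
    using finE assms(1) by (intro card_UN_disjoint[symmetric]) auto
  also have "(\<Union>e\<in>E. {p \<in> V \<times> V. {fst p, snd p} = e}) = (SIGMA v:V. {w\<in>V. {v, w} \<in> E})"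
    by auto
  also have "card \<dots> = (\<Sum>v\<in>V. card {w\<in>V. {v, w} \<in> E})"
    using assms(1) by simp
  finally show ?thesis by simp
qed

text \<open>Every vertex counts as its own non-neighbour.\<close>

definition nonnbrs :: "'a set \<Rightarrow> 'a set set \<Rightarrow> 'a \<Rightarrow> 'a set" where
  "nonnbrs V E v = {w\<in>V. {v, w} \<notin> E}"

lemma finite_nonnbrs: "finite V \<Longrightarrow> finite (nonnbrs V E v)"
  by (simp add: nonnbrs_def)

lemma card_nbrs_plus_nonnbrs:
  assumes "finite V"
  shows "card V = card {w\<in>V. {v, w} \<in> E} + card (nonnbrs V E v)"
proof -
  have "V = {w\<in>V. {v, w} \<in> E} \<union> nonnbrs V E v" by (auto simp: nonnbrs_def)
  moreover have "{w\<in>V. {v, w} \<in> E} \<inter> nonnbrs V E v = {}" by (auto simp: nonnbrs_def)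
  ultimately show ?thesis using assms by (metis card_Un_disjoint finite_Un)
qed

lemma sum_nonnbrs:
  assumes "finite V" "simple_graph V E"
  shows "(\<Sum>v\<in>V. card (nonnbrs V E v)) + 2 * card E = card V * card V"
proof -
  have "card (nonnbrs V E v) + card {w\<in>V. {v, w} \<in> E} = card V" for v
    using card_nbrs_plus_nonnbrs[OF assms(1), of v E] by simp
  then have "card V * card V = (\<Sum>v\<in>V. card (nonnbrs V E v) + card {w\<in>V. {v, w} \<in> E})" by simp
  then show ?thesis using sum_degrees[OF assms] by (simp add: sum.distrib)
qed

text \<open>Union bound: a vertex of \<open>Q\<close> that is not a common neighbour is a
  non-neighbour of one of the \<open>card S\<close> vertices.\<close>

lemma card_common_nbrs:
  assumes "finite V" "Q \<subseteq> V" "finite S" "\<And>a. a \<in> S \<Longrightarrow> card (nonnbrs V E a) \<le> d"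
  shows "card Q \<le> card {w\<in>Q. \<forall>a\<in>S. {a, w} \<in> E} + card S * d"
proof -
  have "card Q \<le> card ({w\<in>Q. \<forall>a\<in>S. {a, w} \<in> E} \<union> (\<Union>a\<in>S. nonnbrs V E a))"
    using assms finite_subset[OF assms(2,1)]
    by (intro card_mono) (auto simp: nonnbrs_def)
  also have "\<dots> \<le> card {w\<in>Q. \<forall>a\<in>S. {a, w} \<in> E} + card (\<Union>a\<in>S. nonnbrs V E a)"
    by (rule card_Un_le)
  also have "card (\<Union>a\<in>S. nonnbrs V E a) \<le> (\<Sum>a\<in>S. card (nonnbrs V E a))"
    using assms(3) by (rule card_UN_le)
  also have "\<dots> \<le> card S * d"
    using sum_bounded_above[of S "\<lambda>a. card (nonnbrs V E a)" d] assms(4) by simp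
  finally show ?thesis by simp
qed

text \<open>Edges lie inside \<open>U\<close>, cross to \<open>V - U\<close> (at most
  \<open>a\<close> per vertex of \<open>U\<close>), or lie inside \<open>V - U\<close>. For the last
  kind, every vertex of \<open>V - U\<close> is its own non-neighbour, and one in \<open>Q\<close>
  still has \<open>1 + b\<close> non-neighbours there after at most \<open>card U\<close> are
  discarded; so the degrees inside \<open>V - U\<close> fall short of the complete graph by at least
  \<open>card Q * b\<close> in total.\<close>

lemma card_split_edges:
  assumes fin: "finite V" and sg: "simple_graph V E" and UV: "U \<subseteq> V" and QV: "Q \<subseteq> V - U"
    and a: "\<And>v. v \<in> U \<Longrightarrow> card {w\<in>V - U. {v, w} \<in> E} \<le> a"
    and b: "\<And>v. v \<in> Q \<Longrightarrow> card U + 1 + b \<le> card (nonnbrs V E v)"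
  shows "2 * card E + card Q * b
    \<le> 2 * card {e\<in>E. e \<subseteq> U} + 2 * (card U * a) + (card V - card U) * (card V - card U - 1)"
proof -
  let ?W = "V - U"
  let ?EU = "{e\<in>E. e \<subseteq> U}" and ?EW = "{e\<in>E. e \<subseteq> ?W}" and ?X = "\<Union>v\<in>U. (\<lambda>w. {v, w}) ` {w\<in>?W. {v, w} \<in> E}"
  have finU: "finite U" using fin UV finite_subset by blast
  have "E \<subseteq> ?EU \<union> ?EW \<union> ?X"
  proof
    fix e assume e: "e \<in> E"
    then obtain x y where xy: "e = {x, y}" "x \<in> V" "y \<in> V"
      using sg by (auto simp: simple_graph_def card_2_iff)
    have X: "e \<in> ?X" if "e = {v, w}" "v \<in> U" "w \<in> ?W" for v w using that e by blast
    have "e = {y, x}" using xy(1) by auto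
    then show "e \<in> ?EU \<union> ?EW \<union> ?X"
      using e xy X[of x y] X[of y x] by (cases "x \<in> U"; cases "y \<in> U") simp_all
  qed
  then have "card E \<le> card (?EU \<union> ?EW \<union> ?X)"
    using finite_simple_graph[OF fin sg] fin finU by (intro card_mono) auto
  also have "\<dots> \<le> card ?EU + card ?EW + card ?X"
    by (meson add_le_mono1 card_Un_le le_trans)
  also have "card ?X \<le> card U * a"
  proof -
    have "card ?X \<le> (\<Sum>v\<in>U. card ((\<lambda>w. {v, w}) ` {w\<in>?W. {v, w} \<in> E}))"
      using finU by (rule card_UN_le)
    also have "\<dots> \<le> (\<Sum>v\<in>U. a)"
    proof (rule sum_mono)
      fix v assume "v \<in> U"
      then show "card ((\<lambda>w. {v, w}) ` {w\<in>?W. {v, w} \<in> E}) \<le> a"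
        using a[of v] card_image_le[of "{w\<in>?W. {v, w} \<in> E}" "\<lambda>w. {v, w}"] fin by simp
    qed
    finally show ?thesis by simp
  qed
  finally have E: "card E \<le> card ?EU + card ?EW + card U * a" by simp
  have cW: "card ?W = card V - card U" using finU UV by (rule card_Diff_subset)
  have "(\<Sum>v\<in>?W. card (nonnbrs ?W ?EW v)) + 2 * card ?EW = card ?W * card ?W"
    using fin sg by (intro sum_nonnbrs) (auto simp: simple_graph_def)
  moreover have "(\<Sum>v\<in>?W. 1 + (if v \<in> Q then b else 0)) \<le> (\<Sum>v\<in>?W. card (nonnbrs ?W ?EW v))"
  proof (rule sum_mono)
    fix v assume v: "v \<in> ?W"
    have "{v, v} \<notin> E" using sg unfolding simple_graph_def by fastforce
    then have "v \<in> nonnbrs ?W ?EW v" using v by (simp add: nonnbrs_def)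
    then have "1 \<le> card (nonnbrs ?W ?EW v)"
      using card_mono[of "nonnbrs ?W ?EW v" "{v}"] finite_nonnbrs[of ?W ?EW v] fin by simp
    moreover have "1 + b \<le> card (nonnbrs ?W ?EW v)" if "v \<in> Q"
    proof -
      have "card (nonnbrs V E v) \<le> card (nonnbrs ?W ?EW v \<union> U)"
        using fin finU by (intro card_mono) (auto simp: nonnbrs_def)
      then show ?thesis using b[OF that] card_Un_le[of "nonnbrs ?W ?EW v" U] by linarith
    qed
    ultimately show "1 + (if v \<in> Q then b else 0) \<le> card (nonnbrs ?W ?EW v)" by simp
  qed
  moreover have "(\<Sum>v\<in>?W. 1 + (if v \<in> Q then b else 0)) = card ?W + card Q * b"
  proof -
    have "(\<Sum>v\<in>?W. if v \<in> Q then b else 0) = (\<Sum>v\<in>?W \<inter> Q. b)"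
      using fin by (intro sum.inter_restrict[symmetric]) simp
    also have "?W \<inter> Q = Q" using QV by blast
    finally show ?thesis by (simp only: sum.distrib) simp
  qed
  ultimately have "card ?W + card Q * b + 2 * card ?EW \<le> card ?W * card ?W" by linarith
  then have "card Q * b + 2 * card ?EW \<le> card ?W * (card ?W - 1)"
    by (simp add: diff_mult_distrib2)
  then show ?thesis using E cW by simp
qed

subsection \<open>Turan numbers\<close>

text \<open>\<open>ex\<close> speaks of graphs on an initial segment of the naturals only, so the
  graph is transported there along a bijection; a copy in the image would pull back to a copy in
  \<open>U\<close>.\<close>

lemma card_le_ex:
  assumes "finite U" "simple_graph U E" "\<not> has_disjoint_copies 1 VF EF U E"
  shows "card E \<le> ex (card U) VF EF"
proof -
  obtain h where h: "bij_betw h U {0..<card U}" using ex_bij_betw_finite_nat[OF assms(1)] by blast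
  let ?g = "inv_into U h" and ?E = "(\<lambda>e. h ` e) ` E"
  have sub: "e \<subseteq> U" if "e \<in> E" for e using assms(2) that by (simp add: simple_graph_def)
  have inj: "inj_on h U" using h by (simp add: bij_betw_def)
  have "card ?E = card E"
    using inj sub by (intro card_image) (auto intro!: inj_onI simp: inj_on_image_eq_iff)
  moreover have "simple_graph {0..<card U} ?E"
    unfolding simple_graph_def
  proof
    fix e' assume "e' \<in> ?E"
    then obtain e where e: "e \<in> E" "e' = h ` e" by blast
    have "h ` e \<subseteq> {0..<card U}" using h sub[OF e(1)] by (auto simp: bij_betw_def)
    moreover have "card (h ` e) = 2"
      using e(1) assms(2) inj_on_subset[OF inj sub[OF e(1)]]
      by (simp add: card_image simple_graph_def)
    ultimately show "e' \<subseteq> {0..<card U} \<and> card e' = 2" using e(2) by simp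
  qed
  moreover have "\<not> has_disjoint_copies 1 VF EF {0..<card U} ?E"
  proof
    assume "has_disjoint_copies 1 VF EF {0..<card U} ?E"
    then obtain f where f: "embeds f VF EF {0..<card U} ?E" unfolding has_disjoint_copies_1_iff by blast
    have g: "bij_betw ?g {0..<card U} U" using h by (rule bij_betw_inv_into)
    have "embeds (?g \<circ> f) VF EF U E"
      unfolding embeds_def
    proof (intro conjI ballI)
      show "inj_on (?g \<circ> f) VF" using f g unfolding embeds_def bij_betw_def
        by (meson comp_inj_on inj_on_subset)
      show "(?g \<circ> f) ` VF \<subseteq> U" using f g unfolding embeds_def bij_betw_def by fastforce
      fix e assume "e \<in> EF"
      then obtain e' where e': "e' \<in> E" "f ` e = h ` e'" using f by (auto simp: embeds_def)
      then have "(?g \<circ> f) ` e = ?g ` h ` e'" by (metis image_comp)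
      also have "\<dots> = e'" using sub[OF e'(1)] inj by simp
      finally show "(?g \<circ> f) ` e \<in> E" using e' by simp
    qed
    then show False using assms(3) unfolding has_disjoint_copies_1_iff by blast
  qed
  \<comment> \<open>On the naturals \<open>Sup\<close> is an upper bound only for bounded sets,
    which finiteness supplies.\<close>
  moreover have "finite {E. simple_graph {0..<card U} E}"
    by (rule finite_subset[of _ "Pow (Pow {0..<card U})"]) (auto simp: simple_graph_def)
  then have "bdd_above {card E |E. simple_graph {0..<card U} E
      \<and> \<not> has_disjoint_copies 1 VF EF {0..<card U} E}"
    by (intro bdd_above_finite) (auto simp: setcompr_eq_image intro: finite_subset)
  ultimately show ?thesis
    unfolding ex_def ex_copies_def by (intro cSup_upper) (auto intro!: exI[of _ ?E])
qed

lemma ex_copies_leI: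
  assumes "\<And>E. simple_graph {0..<n} E \<Longrightarrow> \<not> has_disjoint_copies k VF EF {0..<n} E \<Longrightarrow> card E \<le> b"
  shows "ex_copies n k VF EF \<le> b"
proof (cases "{card E | E. simple_graph {0..<n} E \<and> \<not> has_disjoint_copies k VF EF {0..<n} E} = {}")
  case True
  \<comment> \<open>There may be no admissible graph, for instance when \<open>k = 0\<close>; the
    supremum is then 0.\<close>
  then show ?thesis unfolding ex_copies_def by (simp only: True) (simp add: Sup_nat_def)
next
  case False
  then show ?thesis unfolding ex_copies_def by (rule cSup_least) (use assms in auto)
qed

text \<open>Deleting the vertex \<open>u\<close> loses at most \<open>u\<close> edges and creates no
  copy.\<close>

lemma ex_Suc_le: "ex (Suc u) VF EF \<le> ex u VF EF + u"
proof -
  have "card E \<le> ex u VF EF + u"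
    if sg: "simple_graph {0..<Suc u} E" and free: "\<not> has_disjoint_copies 1 VF EF {0..<Suc u} E" for E
  proof -
    let ?E = "{e\<in>E. e \<subseteq> {0..<u}}"
    have "simple_graph {0..<u} ?E" using sg by (auto simp: simple_graph_def)
    moreover have "\<not> has_disjoint_copies 1 VF EF {0..<u} ?E"
    proof
      assume "has_disjoint_copies 1 VF EF {0..<u} ?E"
      then obtain f where f: "embeds f VF EF {0..<u} ?E" unfolding has_disjoint_copies_1_iff by blast
      have "f ` VF \<subseteq> {0..<Suc u}" using f by (auto simp: embeds_def)
      then have "embeds f VF EF {0..<Suc u} E" using f by (simp add: embeds_def)
      then show False using free unfolding has_disjoint_copies_1_iff by blast
    qed
    ultimately have "card ?E \<le> ex u VF EF" using card_le_ex[of "{0..<u}" ?E] by simp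
    moreover have "E \<subseteq> ?E \<union> (\<lambda>w. {u, w}) ` {0..<u}"
    proof
      fix e assume e: "e \<in> E"
      then obtain x y where xy: "e = {x, y}" "x < Suc u" "y < Suc u" "x \<noteq> y"
        using sg by (auto simp: simple_graph_def card_2_iff)
      have X: "e \<in> (\<lambda>w. {u, w}) ` {0..<u}" if "e = {u, w}" "w < u" for w using that by simp
      have "e = {y, x}" using xy(1) by auto
      then show "e \<in> ?E \<union> (\<lambda>w. {u, w}) ` {0..<u}"
        using e xy X[of x] X[of y] by (cases "x = u"; cases "y = u") simp_all
    qed
    then have "card E \<le> card (?E \<union> (\<lambda>w. {u, w}) ` {0..<u})"
      using finite_simple_graph[OF _ sg] by (intro card_mono) auto
    moreover have "\<dots> \<le> card ?E + card ((\<lambda>w. {u, w}) ` {0..<u})" by (rule card_Un_le)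
    moreover have "card ((\<lambda>w. {u, w}) ` {0..<u}) \<le> u"
      using card_image_le[of "{0..<u}" "\<lambda>w. {u, w}"] by simp
    ultimately show ?thesis by linarith
  qed
  then show ?thesis unfolding ex_def[of "Suc u"] by (rule ex_copies_leI)
qed

text \<open>Passing from \<open>u\<close> to \<open>u + 1\<close> raises the first term by at most
  \<open>u\<close> and lowers the binomial by \<open>n - u - 1\<close>, which is at least
  \<open>u\<close> while \<open>2 * (u + 1) \<le> n\<close>.\<close>

lemma ex_plus_choose_antimono:
  assumes "m \<le> u" "2 * u \<le> n"
  shows "ex u VF EF + (n - u choose 2) \<le> ex m VF EF + (n - m choose 2)"
  using assms
proof (induction u rule: dec_induct)
  case base
  then show ?case by simp
next
  case (step u)
  have "n - u = Suc (n - Suc u)" using step.prems by simp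
  then have "(n - u choose 2) = (n - Suc u choose 2) + (n - Suc u)"
    by (simp add: numeral_2_eq_2)
  then show ?case using step ex_Suc_le[of u VF EF] by simp
qed

subsection \<open>Tiling dense graphs\<close>

text \<open>The leaves \<open>S i\<close> become the smaller part of a copy; the larger part
  consists of the centre \<open>i\<close> and \<open>s2 - 1\<close> common neighbours of the leaves
  in \<open>R\<close>, chosen greedily. Only the leaves must have few non-neighbours, so centres of
  low degree can be covered as well.\<close>

lemma tileable_stars:
  assumes bip: "bipartite_graph s1 s2 W1 W2 EB" and s2: "1 \<le> s2"
    and fin: "finite V" and IV: "I \<subseteq> V" and RV: "R \<subseteq> V"
    and S: "\<And>i. i \<in> I \<Longrightarrow> S i \<subseteq> V \<and> card (S i) = s1 \<and> (\<forall>a\<in>S i. {a, i} \<in> E)"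
    and disj: "disjoint_family_on S I" "I \<inter> (\<Union>i\<in>I. S i) = {}" "R \<inter> (I \<union> (\<Union>i\<in>I. S i)) = {}"
    and d: "\<And>i a. i \<in> I \<Longrightarrow> a \<in> S i \<Longrightarrow> card (nonnbrs V E a) \<le> d"
    and room: "s1 * d + (s2 - 1) * card I \<le> card R"
  shows "\<exists>X\<subseteq>R. card X \<le> (s2 - 1) * card I \<and> tileable (W1 \<union> W2) EB E (I \<union> (\<Union>i\<in>I. S i) \<union> X)"
proof -
  let ?N = "\<lambda>i. {w\<in>R. \<forall>a\<in>S i. {a, w} \<in> E}"
  have finI: "finite I" and finR: "finite R" using fin IV RV finite_subset by auto
  have finS: "finite (S i)" if "i \<in> I" for i using S[OF that] fin finite_subset by blast
  have "\<exists>B. (\<forall>i\<in>I. B i \<subseteq> ?N i \<and> card (B i) = s2 - 1) \<and> disjoint_family_on B I"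
  proof (rule disjoint_subsets_greedy[OF finI])
    show "finite (?N i)" if "i \<in> I" for i using finR by simp
    show "(s2 - 1) * card I \<le> card (?N i)" if "i \<in> I" for i
      using card_common_nbrs[OF fin RV finS[OF that], of E d] d[OF that] S[OF that] room by simp
  qed
  then obtain B where B': "\<forall>i\<in>I. B i \<subseteq> ?N i \<and> card (B i) = s2 - 1"
      and disjB: "disjoint_family_on B I" by (elim exE conjE)
  note B = bspec[OF B']
  let ?T = "\<lambda>i. S i \<union> insert i (B i)"
  have BR: "B i \<subseteq> R" if "i \<in> I" for i using B[OF that] by blast
  have finB: "finite (B i)" if "i \<in> I" for i using BR[OF that] finR by (rule finite_subset)
  have "tileable (W1 \<union> W2) EB E (?T i)" if i: "i \<in> I" for i
  proof (rule tileable_complete_bipartite[OF bip])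
    have "i \<notin> B i" using BR[OF i] i disj(3) by blast
    then show "card (insert i (B i)) = s2" using B[OF i] finB[OF i] s2 by simp
    show "S i \<inter> insert i (B i) = {}" using BR[OF i] i disj(2,3) by blast
    show "{a, b} \<in> E" if "a \<in> S i" "b \<in> insert i (B i)" for a b
      using that B[OF i] S[OF i] by blast
  qed (use finS finB S i in auto)
  moreover have "disjoint_family_on ?T I"
    unfolding disjoint_family_on_def
  proof (intro ballI impI)
    fix i j assume ij: "i \<in> I" "j \<in> I" "i \<noteq> j"
    have "S i \<inter> S j = {}" "B i \<inter> B j = {}"
      using disj(1) disjB ij by (auto simp: disjoint_family_on_def)
    moreover have "i \<notin> S j" "j \<notin> S i" "i \<notin> B j" "j \<notin> B i" "S i \<inter> B j = {}" "S j \<inter> B i = {}"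
      using ij disj(2,3) BR[OF ij(1)] BR[OF ij(2)] by blast+
    ultimately show "?T i \<inter> ?T j = {}" using ij(3) by blast
  qed
  ultimately have "tileable (W1 \<union> W2) EB E (\<Union>i\<in>I. ?T i)"
    using finI by (intro tileable_UN)
  moreover have "(\<Union>i\<in>I. ?T i) = I \<union> (\<Union>i\<in>I. S i) \<union> (\<Union>i\<in>I. B i)" by blast
  moreover have "card (\<Union>i\<in>I. B i) \<le> (s2 - 1) * card I"
  proof -
    have "(\<Sum>i\<in>I. card (B i)) = (\<Sum>i\<in>I. s2 - 1)" using B by (intro sum.cong) blast+
    then show ?thesis using card_UN_le[OF finI, of B] by (simp add: mult.commute)
  qed
  moreover have "(\<Union>i\<in>I. B i) \<subseteq> R" using BR by blast
  ultimately show ?thesis by (intro exI[of _ "\<Union>i\<in>I. B i"]) simp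
qed

text \<open>Split almost all of \<open>R\<close> into \<open>q\<close> blocks of size
  \<open>s1\<close> and a set \<open>Y\<close> of \<open>q * s2\<close> vertices, give every block
  \<open>s2\<close> slots, and match the slots with \<open>Y\<close> so that each vertex is adjacent
  to its whole block. A slot rejects at most \<open>s1 * d\<close> vertices and a vertex is rejected
  by at most \<open>s2 * d\<close> slots.\<close>

lemma tileable_dense_set:
  assumes bip: "bipartite_graph s1 s2 W1 W2 EB" and s2: "1 \<le> s2"
    and fin: "finite V" and RV: "R \<subseteq> V"
    and d: "\<And>a. a \<in> R \<Longrightarrow> card (nonnbrs V E a) \<le> d"
    and room: "s1 * d + s2 * d < s2 * (card R div (s1 + s2))"
  shows "\<exists>X\<subseteq>R. card R < card X + (s1 + s2) \<and> tileable (W1 \<union> W2) EB E X"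
proof -
  define q where "q = card R div (s1 + s2)"
  have finR: "finite R" using fin RV finite_subset by blast
  have qs: "q * (s1 + s2) \<le> card R" "card R < q * (s1 + s2) + (s1 + s2)"
    using s2 unfolding q_def
    by (simp, metis add.commute add_gr_0 dividend_less_div_times less_le_trans zero_less_one)
  obtain X where X: "X \<subseteq> R" "card X = q * s1"
    using obtain_subset_with_card_n[of "q * s1" R] qs by (auto simp: algebra_simps)
  have finX: "finite X" using X(1) finR finite_subset by blast
  have "q * s2 \<le> card (R - X)" using X finX qs(1) by (simp add: card_Diff_subset add_mult_distrib2)
  then obtain Y where Y: "Y \<subseteq> R - X" "card Y = q * s2"
    using obtain_subset_with_card_n[of "q * s2" "R - X"] qs(1) by (auto simp: add_mult_distrib2)
  have finY: "finite Y" using Y(1) finR finite_subset by blast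
  obtain A where A: "\<And>i. i < q \<Longrightarrow> A i \<subseteq> X \<and> card (A i) = s1" and disjA: "disjoint_family_on A {..<q}"
    using disjoint_subsets_greedy[of "{..<q}" "\<lambda>_. X" s1] finX X(2) by (auto simp: mult.commute)
  have finA: "finite (A i)" if "i < q" for i using A[OF that] finX finite_subset by blast
  let ?slots = "{..<q} \<times> {..<s2}" and ?R = "\<lambda>(i, j::nat) y. \<forall>a\<in>A i. {a, y} \<in> E"
  have "\<exists>p. bij_betw p ?slots Y \<and> (\<forall>x\<in>?slots. ?R x (p x))"
  proof (rule perfect_matching_dense)
    show "card {y\<in>Y. \<not> ?R x y} \<le> s1 * d" if "x \<in> ?slots" for x
    proof -
      obtain i j where x: "x = (i, j)" "i < q" using \<open>x \<in> ?slots\<close> by auto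
      have "card {y\<in>Y. \<not> ?R x y} + card {y\<in>Y. ?R x y} = card Y"
        using finY by (subst card_Un_disjoint[symmetric]) (auto intro: arg_cong[where f = card])
      moreover have "card Y \<le> card {y\<in>Y. \<forall>a\<in>A i. {a, y} \<in> E} + card (A i) * d"
        using Y(1) RV A[OF x(2)] X(1) by (intro card_common_nbrs[OF fin _ finA[OF x(2)]] d) auto
      ultimately show ?thesis using A[OF x(2)] x(1) by simp
    qed
    show "card {x\<in>?slots. \<not> ?R x y} \<le> s2 * d" if y: "y \<in> Y" for y
    proof -
      let ?I = "{i. i < q \<and> (\<exists>a\<in>A i. {a, y} \<notin> E)}"
      have "\<forall>i\<in>?I. \<exists>a. a \<in> A i \<and> {a, y} \<notin> E" by blast
      then obtain g where "\<forall>i\<in>?I. g i \<in> A i \<and> {g i, y} \<notin> E" by (rule bchoice[THEN exE])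
      note g = bspec[OF this]
      \<comment> \<open>The blocks are disjoint, so choosing a non-neighbour of \<open>y\<close> in
        each block that rejects \<open>y\<close> yields distinct non-neighbours. Hence at most
        \<open>d\<close> blocks reject \<open>y\<close>.\<close>
      have "inj_on g ?I"
      proof (rule inj_onI, rule ccontr)
        fix i j assume ij: "i \<in> ?I" "j \<in> ?I" "g i = g j" "i \<noteq> j"
        then have "A i \<inter> A j = {}" using disjA by (auto simp: disjoint_family_on_def)
        then show False using g[OF ij(1)] g[OF ij(2)] ij(3) by auto
      qed
      moreover have "g ` ?I \<subseteq> nonnbrs V E y"
      proof
        fix a assume "a \<in> g ` ?I"
        then obtain i where i: "i \<in> ?I" "a = g i" by blast
        then have "a \<in> V" using g[OF i(1)] A[of i] X(1) RV by blast
        moreover have "{y, a} = {a, y}" by auto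
        ultimately show "a \<in> nonnbrs V E y" using g[OF i(1)] i(2) by (simp add: nonnbrs_def)
      qed
      ultimately have "card ?I \<le> card (nonnbrs V E y)"
        by (rule card_inj_on_le[OF _ _ finite_nonnbrs[OF fin]])
      also have "\<dots> \<le> d" using d y Y(1) by blast
      finally have I: "card ?I \<le> d" .
      have "{x\<in>?slots. \<not> ?R x y} = ?I \<times> {..<s2}" by auto
      then have "card {x\<in>?slots. \<not> ?R x y} = card ?I * s2" by (simp add: card_cartesian_product)
      then show ?thesis using I by (simp add: mult.commute)
    qed
    show "s1 * d + s2 * d < card ?slots" using room by (simp add: q_def mult.commute)
  qed (use finY Y(2) in auto)
  then obtain p where p: "bij_betw p ?slots Y" and pR: "\<And>i j. i < q \<Longrightarrow> j < s2 \<Longrightarrow> \<forall>a\<in>A i. {a, p (i, j)} \<in> E"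
    by auto
  let ?B = "\<lambda>i. (\<lambda>j. p (i, j)) ` {..<s2}"
  let ?T = "\<lambda>i. A i \<union> ?B i"
  have BY: "?B i \<subseteq> Y" if "i < q" for i using p that by (auto simp: bij_betw_def)
  have pinj: "p (i, j) = p (i', j') \<longleftrightarrow> i = i' \<and> j = j'" if "i < q" "i' < q" "j < s2" "j' < s2" for i i' j j'
    using p that inj_on_eq_iff[of p ?slots "(i, j)" "(i', j')"] by (auto simp: bij_betw_def)
  have cB: "card (?B i) = s2" if "i < q" for i
    using that pinj by (subst card_image) (auto intro: inj_onI)
  have AB: "A i \<inter> ?B j = {}" if "i < q" "j < q" for i j
    using A[OF that(1)] BY[OF that(2)] Y(1) by blast
  have "tileable (W1 \<union> W2) EB E (?T i)" if i: "i < q" for i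
    using finA[OF i] A[OF i] cB[OF i] AB[OF i i] pR[OF i]
    by (intro tileable_complete_bipartite[OF bip]) auto
  moreover have disjT: "disjoint_family_on ?T {..<q}"
    unfolding disjoint_family_on_def
  proof (intro ballI impI)
    fix i j assume ij: "i \<in> {..<q}" "j \<in> {..<q}" "i \<noteq> j"
    have "A i \<inter> A j = {}" using disjA ij by (auto simp: disjoint_family_on_def)
    moreover have "?B i \<inter> ?B j = {}" using ij pinj by auto
    ultimately show "?T i \<inter> ?T j = {}" using AB[of i j] AB[of j i] ij by blast
  qed
  ultimately have "tileable (W1 \<union> W2) EB E (\<Union>i<q. ?T i)"
    by (intro tileable_UN) auto
  moreover have "card (\<Union>i<q. ?T i) = (\<Sum>i<q. card (?T i))"
    using disjT finA by (intro card_UN_disjoint) (auto simp: disjoint_family_on_def)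
  moreover have "card (?T i) = s1 + s2" if "i < q" for i
    using that A[OF that] cB[OF that] AB[OF that that] finA[OF that] by (simp add: card_Un_disjoint)
  moreover have "(\<Union>i<q. ?T i) \<subseteq> R" using A BY X(1) Y(1) by blast
  ultimately show ?thesis using qs(2) by (intro exI[of _ "\<Union>i<q. ?T i"]) simp
qed

text \<open>Vertices of \<open>M\<close> may have too many non-neighbours to be treated by a matching, and there may be
  too many of them to spend one copy on each; placing them in the larger part of copies whose smaller
  part lies in \<open>P\<close> uses up few vertices of \<open>P\<close>.\<close>

lemma tileable_medium:
  assumes bip: "bipartite_graph s1 s2 W1 W2 EB" and s: "1 \<le> s1" "s1 \<le> s2"
    and fin: "finite V" and MV: "M \<subseteq> V" and PV: "P \<subseteq> V" and MP: "M \<inter> P = {}"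
    and d: "\<And>a. a \<in> M \<Longrightarrow> card (nonnbrs V E a) \<le> d"
    and room: "card M + 2 * s1 * d + s1 \<le> card P"
  shows "\<exists>X\<subseteq>M \<union> P. tileable (W1 \<union> W2) EB E X \<and> card (X \<inter> P) \<le> card M \<and> card (M - X) < 2 * s2"
proof -
  have finM: "finite M" and finP: "finite P" using fin MV PV finite_subset by auto
  \<comment> \<open>Every copy added below has \<open>s1\<close> vertices in \<open>P\<close> and
    \<open>s2 \<ge> s1\<close> in \<open>M\<close>, so the inequality survives and at most
    \<open>card M\<close> vertices of \<open>P\<close> are ever used.\<close>
  define ok where "ok X \<longleftrightarrow> X \<subseteq> M \<union> P \<and> tileable (W1 \<union> W2) EB E X
    \<and> card (X \<inter> P) \<le> card (X \<inter> M)" for X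
  have "ok {}" by (simp add: ok_def tileable_empty)
  moreover have "card X < card (M \<union> P) + 1" if "ok X" for X
    using that finM finP card_mono[of "M \<union> P" X] by (simp add: ok_def)
  ultimately obtain X where X: "ok X" and max: "\<And>Y. ok Y \<Longrightarrow> card Y \<le> card X"
    using ex_has_greatest_nat[of ok "{}" card "card (M \<union> P) + 1"] by (metis less_imp_le)
  have finX: "finite X" using X finM finP by (meson finite_UnI finite_subset ok_def)
  have XM: "card (X \<inter> M) \<le> card M" using finM by (simp add: card_mono)
  have "card (M - X) < 2 * s2"
  proof (rule ccontr)
    assume "\<not> ?thesis"
    then obtain Y where Y: "Y \<subseteq> M - X" "card Y = 2 * s2"
      using obtain_subset_with_card_n[of "2 * s2" "M - X"] by auto
    have finY: "finite Y" using Y(1) finM finite_subset by blast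
    \<comment> \<open>If each of \<open>s1\<close> vertices misses at most \<open>e\<close> of the
      \<open>2 * s2\<close> vertices of \<open>Y\<close>, then since \<open>s1 * e \<le> s2\<close>
      they have \<open>s2\<close> common neighbours in \<open>Y\<close>.\<close>
    define e where "e = s2 div s1"
    let ?P = "P - X" and ?G = "{a\<in>P - X. card (nonnbrs Y E a) \<le> e}" and ?H = "{a\<in>P - X. \<not> card (nonnbrs Y E a) \<le> e}"
    have "card (P - X \<inter> P) = card P - card (X \<inter> P)"
      using finX by (intro card_Diff_subset) auto
    then have cP: "2 * s1 * d + s1 \<le> card ?P"
      using room X XM unfolding ok_def by (simp add: Diff_Int) linarith
    \<comment> \<open>Non-adjacent pairs between \<open>P - X\<close> and \<open>Y\<close> are
      counted from both sides. As \<open>s2 \<le> s1 * (e + 1)\<close>, at most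
      \<open>2 * s1 * d\<close> vertices of \<open>P - X\<close> miss more than \<open>e\<close> of
      \<open>Y\<close>, and \<open>s1\<close> good ones remain.\<close>
    have "(\<Sum>a\<in>?P. card (nonnbrs Y E a)) = (\<Sum>y\<in>Y. card {a\<in>?P. {a, y} \<notin> E})"
      unfolding nonnbrs_def using finP finY by (intro sum_multicount_gen) auto
    also have "\<dots> \<le> (\<Sum>y\<in>Y. d)"
    proof (rule sum_mono)
      fix y assume y: "y \<in> Y"
      have "{a\<in>?P. {a, y} \<notin> E} \<subseteq> nonnbrs V E y"
        using PV by (auto simp: nonnbrs_def insert_commute)
      then have "card {a\<in>?P. {a, y} \<notin> E} \<le> card (nonnbrs V E y)"
        by (rule card_mono[OF finite_nonnbrs[OF fin]])
      also have "\<dots> \<le> d" using y Y(1) d by blast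
      finally show "card {a\<in>?P. {a, y} \<notin> E} \<le> d" .
    qed
    also have "\<dots> = 2 * s2 * d" using Y(2) by simp
    finally have total: "(\<Sum>a\<in>?P. card (nonnbrs Y E a)) \<le> 2 * s2 * d" .
    have "card ?H * (e + 1) = (\<Sum>a\<in>?H. e + 1)" by simp
    also have "\<dots> \<le> (\<Sum>a\<in>?H. card (nonnbrs Y E a))" by (rule sum_mono) auto
    also have "\<dots> \<le> (\<Sum>a\<in>?P. card (nonnbrs Y E a))" using finP by (intro sum_mono2) auto
    finally have H: "card ?H * (e + 1) \<le> 2 * s2 * d" using total by linarith
    have s2e: "s2 \<le> s1 * (e + 1)"
      using s(1) unfolding e_def by (simp add: less_imp_le_nat dividend_less_times_div)
    have "card ?H * s2 \<le> card ?H * (s1 * (e + 1))" using s2e by (rule mult_le_mono2)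
    also have "\<dots> \<le> s1 * (2 * s2 * d)" using mult_le_mono2[OF H, of s1] by (simp only: mult_ac)
    also have "\<dots> = (2 * s1 * d) * s2" by simp
    finally have "card ?H \<le> 2 * s1 * d" using s by (simp add: mult_le_cancel2)
    moreover have "card ?P = card ?G + card ?H"
      using finP by (subst card_Un_disjoint[symmetric]) (auto intro: arg_cong[where f = card])
    ultimately have "s1 \<le> card ?G" using cP by linarith
    then obtain A where A: "A \<subseteq> ?G" "card A = s1" by (meson obtain_subset_with_card_n)
    have finA: "finite A" using finite_subset[OF A(1)] finP by simp
    have "card Y \<le> card {w\<in>Y. \<forall>a\<in>A. {a, w} \<in> E} + card A * e"
      using A(1) by (intro card_common_nbrs[OF finY _ finA]) auto
    moreover have "s1 * e \<le> s2" unfolding e_def by simp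
    ultimately have "s2 \<le> card {w\<in>Y. \<forall>a\<in>A. {a, w} \<in> E}" using A(2) Y(2) by simp
    then obtain B where B: "B \<subseteq> {w\<in>Y. \<forall>a\<in>A. {a, w} \<in> E}" "card B = s2"
      by (meson obtain_subset_with_card_n)
    have finB: "finite B" using finite_subset[OF B(1)] finY by simp
    have sub: "A \<subseteq> P" "A \<inter> X = {}" "B \<subseteq> M" "B \<inter> X = {}" using A(1) B(1) Y(1) by auto
    have "tileable (W1 \<union> W2) EB E (A \<union> B)"
      using finA finB A(2) B sub MP by (intro tileable_complete_bipartite[OF bip]) auto
    then have "tileable (W1 \<union> W2) EB E (X \<union> (A \<union> B))"
      using X sub by (intro tileable_Un[of _ _ _ X]) (auto simp: ok_def)
    moreover have "card ((X \<union> (A \<union> B)) \<inter> P) = card (X \<inter> P) + s1"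
    proof -
      have "(X \<union> (A \<union> B)) \<inter> P = X \<inter> P \<union> A" using sub MP by blast
      moreover have "X \<inter> P \<inter> A = {}" using sub by blast
      ultimately show ?thesis using finX finA A(2) by (simp add: card_Un_disjoint)
    qed
    moreover have "card ((X \<union> (A \<union> B)) \<inter> M) = card (X \<inter> M) + s2"
    proof -
      have "(X \<union> (A \<union> B)) \<inter> M = X \<inter> M \<union> B" using sub MP by blast
      moreover have "X \<inter> M \<inter> B = {}" using sub by blast
      ultimately show ?thesis using finX finB B(2) by (simp add: card_Un_disjoint)
    qed
    ultimately have "ok (X \<union> (A \<union> B))" using X sub s by (auto simp: ok_def)
    moreover have "card (X \<union> (A \<union> B)) \<ge> card X + s1"
    proof -
      have "card (X \<union> A) = card X + s1" using finX finA sub A(2) by (simp add: card_Un_disjoint Int_commute)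
      moreover have "card (X \<union> A) \<le> card (X \<union> (A \<union> B))" using finX finA finB by (intro card_mono) auto
      ultimately show ?thesis by simp
    qed
    ultimately show False using max[of "X \<union> (A \<union> B)"] s by simp
  qed
  then show ?thesis using X XM by (auto simp: ok_def intro!: exI[of _ X])
qed

text \<open>The leaves of the given stars are set aside first. Copies then absorb all but fewer than
  \<open>2 * s2\<close> of the other vertices of \<open>M\<close>; these leftovers become centres of
  new stars with leaves in \<open>P\<close>. All stars are extended to copies, and what is left lies
  in \<open>P\<close> and is tiled by the matching argument. In units of \<open>n / 65\<close>, the
  free part of \<open>P\<close> shrinks from 57 to 53, 45 and 37, up to multiples of
  \<open>K\<close>.\<close>

lemma tileable_almost_all:
  assumes bip: "bipartite_graph s1 s2 W1 W2 EB" and s: "1 \<le> s1" "s1 \<le> s2"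
    and fin: "finite V" and n: "card V = n" "100 * (s1 + s2)\<^sup>2 \<le> n"
    and sub: "I \<subseteq> V" "M \<subseteq> V" "P \<subseteq> V" and disj: "I \<inter> M = {}" "I \<inter> P = {}" "M \<inter> P = {}"
    and S: "\<And>i. i \<in> I \<Longrightarrow> S i \<subseteq> M \<union> P \<and> card (S i) = s1 \<and> (\<forall>a\<in>S i. {a, i} \<in> E)"
    and disjS: "disjoint_family_on S I"
    and dMP: "\<And>v. v \<in> M \<union> P \<Longrightarrow> 4 * s1 * card (nonnbrs V E v) \<le> n"
    and dP: "\<And>v. v \<in> P \<Longrightarrow> 8 * (s1 + s2) * card (nonnbrs V E v) \<le> n"
    and cI: "65 * (s1 + s2) * card I \<le> 8 * n" and cM: "65 * card M \<le> 8 * n"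
    and cP: "57 * n \<le> 65 * card P"
  shows "\<exists>X\<subseteq>I \<union> M \<union> P. tileable (W1 \<union> W2) EB E X \<and> card (I \<union> M \<union> P) < card X + (s1 + s2)"
proof -
  \<comment> \<open>\<open>K\<close> is a common bound for all terms independent of
    \<open>n\<close>; it is at most \<open>n / 100\<close>.\<close>
  define K where "K = (s1 + s2)\<^sup>2"
  have "s1 + s2 \<le> K" using s by (simp add: K_def power2_eq_square)
  moreover have "s1 * s2 \<le> K" "s2 * s2 \<le> K" by (simp_all add: K_def power2_eq_square algebra_simps)
  ultimately have K: "s1 * s2 \<le> K" "s2 * s2 \<le> K" "s1 + s2 \<le> K" "s1 \<le> K" "100 * K \<le> n"
    using n(2) by (auto simp: K_def)
  define d1 where "d1 = n div (4 * s1)"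
  define d2 where "d2 = n div (8 * (s1 + s2))"
  have d1: "4 * (s1 * d1) \<le> n" unfolding d1_def using times_div_less_eq_dividend[of "4 * s1" n] by (simp add: mult.assoc)
  have d2: "8 * ((s1 + s2) * d2) \<le> n" unfolding d2_def using times_div_less_eq_dividend[of "8 * (s1 + s2)" n] by (simp only: mult.assoc)
  have d1': "card (nonnbrs V E v) \<le> d1" if "v \<in> M \<union> P" for v
    using dMP[OF that] s unfolding d1_def by (subst less_eq_div_iff_mult_less_eq) (auto simp: mult_ac)
  have d2': "card (nonnbrs V E v) \<le> d2" if "v \<in> P" for v
    using dP[OF that] s unfolding d2_def by (subst less_eq_div_iff_mult_less_eq) (auto simp: mult_ac)
  have d1s: "d1 \<le> s1 * d1" using s by simp
  have finI: "finite I" and finM: "finite M" and finP: "finite P" using fin sub by (auto intro: finite_subset)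
  define L1 where "L1 = (\<Union>i\<in>I. S i)"
  define M1 where "M1 = M - L1"
  define P1 where "P1 = P - L1"
  have L1sub: "L1 \<subseteq> M \<union> P" using S by (auto simp: L1_def)
  have finL1: "finite L1" using L1sub finM finP finite_subset by blast
  have "card L1 \<le> (\<Sum>i\<in>I. card (S i))" unfolding L1_def by (rule card_UN_le[OF finI])
  also have "\<dots> = s1 * card I" using S by simp
  finally have "card L1 \<le> s1 * card I" .
  moreover have "2 * (s1 * card I) \<le> (s1 + s2) * card I" using s by (simp add: add_mult_distrib)
  ultimately have cL1: "65 * card L1 \<le> 4 * n" using cI unfolding mult.assoc by linarith
  have "card P - card L1 \<le> card P1" unfolding P1_def by (rule diff_card_le_card_Diff[OF finL1])
  then have cP1: "53 * n \<le> 65 * card P1" using cP cL1 by linarith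
  have cM1: "card M1 \<le> card M" using finM by (simp add: M1_def card_mono)
  have "\<exists>X\<subseteq>M1 \<union> P1. tileable (W1 \<union> W2) EB E X \<and> card (X \<inter> P1) \<le> card M1 \<and> card (M1 - X) < 2 * s2"
  proof (rule tileable_medium[OF bip s fin])
    show "card M1 + 2 * s1 * d1 + s1 \<le> card P1"
      using cM1 cM cP1 d1 K unfolding mult.assoc by linarith
  qed (use sub disj d1' in \<open>auto simp: M1_def P1_def\<close>)
  then obtain X1 where X1: "X1 \<subseteq> M1 \<union> P1" "tileable (W1 \<union> W2) EB E X1"
      "card (X1 \<inter> P1) \<le> card M1" "card (M1 - X1) < 2 * s2" by blast
  define M2 where "M2 = M1 - X1"
  define P2 where "P2 = P1 - X1"
  have fin2: "finite P1" "finite M2" "finite P2" using finM finP by (auto simp: M1_def P1_def M2_def P2_def)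
  have "card (P1 - X1 \<inter> P1) = card P1 - card (X1 \<inter> P1)"
    using fin2 by (intro card_Diff_subset) auto
  then have cP2: "45 * n \<le> 65 * card P2"
    using cP1 cM1 cM X1(3) unfolding P2_def by (simp add: Diff_Int)
  have cM2: "card M2 \<le> 2 * s2" using X1(4) by (simp add: M2_def)
  have subs: "M2 \<subseteq> M" "P2 \<subseteq> P" "P2 \<subseteq> V" "M2 \<inter> L1 = {}" "P2 \<inter> L1 = {}" "P2 \<inter> X1 = {}" "M2 \<inter> X1 = {}"
    using sub by (auto simp: M2_def M1_def P2_def P1_def)
  have s1M2: "s1 * card M2 \<le> 2 * K"
    using mult_le_mono2[OF cM2, of s1] K(1) by linarith
  \<comment> \<open>A leftover vertex misses at most \<open>d1 \<le> n / 4\<close> vertices, whereas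
    the greedy choice needs only \<open>2 * K\<close> neighbours in \<open>P2\<close>.\<close>
  have "\<exists>T. (\<forall>y\<in>M2. T y \<subseteq> {w\<in>P2. {y, w} \<in> E} \<and> card (T y) = s1) \<and> disjoint_family_on T M2"
  proof (rule disjoint_subsets_greedy[OF fin2(2)])
    fix y assume y: "y \<in> M2"
    show "finite {w\<in>P2. {y, w} \<in> E}" using fin2 by simp
    have "card P2 \<le> card {w\<in>P2. \<forall>a\<in>{y}. {a, w} \<in> E} + card {y} * d1"
      using y subs(1) by (intro card_common_nbrs[OF fin subs(3)] d1') auto
    then have "card P2 \<le> card {w\<in>P2. {y, w} \<in> E} + d1" by simp
    then show "s1 * card M2 \<le> card {w\<in>P2. {y, w} \<in> E}"
      using s1M2 cP2 d1 d1s K by linarith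
  qed
  then obtain T where T': "\<forall>y\<in>M2. T y \<subseteq> {w\<in>P2. {y, w} \<in> E} \<and> card (T y) = s1"
      and disjT: "disjoint_family_on T M2" by (elim exE conjE)
  note T = bspec[OF T']
  define J where "J = I \<union> M2"
  define S' where "S' i = (if i \<in> M2 then T i else S i)" for i
  define L2 where "L2 = (\<Union>y\<in>M2. T y)"
  have IM2: "I \<inter> M2 = {}" using disj subs by blast
  have L2P2: "L2 \<subseteq> P2" using T unfolding L2_def by blast
  have S'I: "S' i = S i" if "i \<in> I" for i using that IM2 by (auto simp: S'_def)
  have S'M: "S' i = T i" if "i \<in> M2" for i using that by (simp add: S'_def)
  have UNS': "(\<Union>i\<in>J. S' i) = L1 \<union> L2"
    using S'I S'M by (auto simp: J_def L1_def L2_def)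
  have S'J: "S' i \<subseteq> M \<union> P \<and> card (S' i) = s1 \<and> (\<forall>a\<in>S' i. {a, i} \<in> E)" if "i \<in> J" for i
  proof (cases "i \<in> M2")
    case True
    have "{a, i} = {i, a}" for a by auto
    then show ?thesis using T[OF True] S'M[OF True] subs(2) by auto
  next
    case False
    then show ?thesis using S S'I that by (simp add: J_def)
  qed
  have disjS': "disjoint_family_on S' J"
    unfolding disjoint_family_on_def
  proof (intro ballI impI)
    fix i j assume ij: "i \<in> J" "j \<in> J" "i \<noteq> j"
    have TS: "T y \<inter> S i = {}" if "y \<in> M2" "i \<in> I" for y i
      using that L2P2 subs(5) by (auto simp: L2_def L1_def)
    consider "i \<in> I" "j \<in> I" | "i \<in> I" "j \<in> M2" | "i \<in> M2" "j \<in> I" | "i \<in> M2" "j \<in> M2"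
      using ij by (auto simp: J_def)
    then show "S' i \<inter> S' j = {}"
    proof cases
      case 1
      then show ?thesis using disjS ij(3) S'I by (simp add: disjoint_family_on_def)
    next
      case 2
      then show ?thesis using TS[of j i] S'I S'M by (simp add: Int_commute)
    next
      case 3
      then show ?thesis using TS[of i j] S'I S'M by simp
    next
      case 4
      then show ?thesis using disjT ij(3) S'M by (simp add: disjoint_family_on_def)
    qed
  qed
  have "card L2 \<le> (\<Sum>y\<in>M2. card (T y))" unfolding L2_def by (rule card_UN_le[OF fin2(2)])
  also have "\<dots> = (\<Sum>y\<in>M2. s1)" using T by (intro sum.cong) blast+
  finally have cL2: "card L2 \<le> 2 * K" using s1M2 by (simp add: mult.commute)
  have finL2: "finite L2" using L2P2 fin2 finite_subset by blast
  define R where "R = P2 - L2"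
  have "card P2 - card L2 \<le> card R" unfolding R_def by (rule diff_card_le_card_Diff[OF finL2])
  then have cR: "45 * n \<le> 65 * card R + 130 * K" using cP2 cL2 by linarith
  have finR: "finite R" using fin2 by (simp add: R_def)
  have "card J \<le> card I + card M2" unfolding J_def by (rule card_Un_le)
  then have "(s2 - 1) * card J \<le> s2 * (card I + card M2)" by (intro mult_le_mono) auto
  also have "\<dots> \<le> s2 * card I + 2 * K"
    using mult_le_mono2[OF cM2, of s2] K(2) unfolding add_mult_distrib2 by linarith
  finally have J1: "(s2 - 1) * card J \<le> s2 * card I + 2 * K" .
  have "s2 * card I \<le> (s1 + s2) * card I" by simp
  then have "65 * (s2 * card I) \<le> 8 * n" using cI unfolding mult.assoc by linarith
  then have cJ: "65 * ((s2 - 1) * card J) \<le> 8 * n + 130 * K" using J1 by linarith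
  have RJ: "R \<inter> (J \<union> (L1 \<union> L2)) = {}"
    using subs disj by (auto simp: R_def J_def)
  have "\<exists>Z\<subseteq>R. card Z \<le> (s2 - 1) * card J \<and> tileable (W1 \<union> W2) EB E (J \<union> (\<Union>i\<in>J. S' i) \<union> Z)"
  proof (rule tileable_stars[OF bip _ fin _ _ _ disjS'])
    show "J \<subseteq> V" "R \<subseteq> V" using sub subs by (auto simp: J_def R_def)
    show "S' i \<subseteq> V \<and> card (S' i) = s1 \<and> (\<forall>a\<in>S' i. {a, i} \<in> E)" if "i \<in> J" for i
      using S'J[OF that] sub by auto
    have "I \<inter> L1 = {}" using L1sub disj by auto
    moreover have "I \<inter> L2 = {}" using L2P2 subs(2) disj(2) by auto
    moreover have "M2 \<inter> L2 = {}" using L2P2 subs(1,2) disj(3) by auto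
    ultimately show "J \<inter> \<Union> (S' ` J) = {}"
      unfolding UNS' unfolding J_def by (simp add: Int_Un_distrib Int_Un_distrib2 subs(4))
    show "R \<inter> (J \<union> \<Union> (S' ` J)) = {}" unfolding UNS' by (rule RJ)
    show "card (nonnbrs V E a) \<le> d1" if "i \<in> J" "a \<in> S' i" for i a
      using S'J[OF that(1)] that(2) d1' by blast
    show "s1 * d1 + (s2 - 1) * card J \<le> card R" using d1 cJ cR K by linarith
  qed (use s in simp)
  then obtain Z where Z: "Z \<subseteq> R" "card Z \<le> (s2 - 1) * card J"
      "tileable (W1 \<union> W2) EB E (J \<union> (L1 \<union> L2) \<union> Z)" unfolding UNS' by blast
  have finZ: "finite Z" using Z(1) finR finite_subset by blast
  define R' where "R' = R - Z"
  have finR': "finite R'" using finR by (simp add: R'_def)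
  have "card R - card Z \<le> card R'" unfolding R'_def by (rule diff_card_le_card_Diff[OF finZ])
  then have cR': "37 * n \<le> 65 * card R' + 260 * K" using cR Z(2) cJ by linarith
  have "\<exists>X\<subseteq>R'. card R' < card X + (s1 + s2) \<and> tileable (W1 \<union> W2) EB E X"
  proof (rule tileable_dense_set[OF bip _ fin])
    show "R' \<subseteq> V" using subs by (auto simp: R'_def R_def)
    show "card (nonnbrs V E a) \<le> d2" if "a \<in> R'" for a
      using that subs(2) by (intro d2') (auto simp: R'_def R_def)
    let ?q = "card R' div (s1 + s2)"
    have "card R' < (s1 + s2) * ?q + (s1 + s2)"
      using s by (metis add_gr_0 dividend_less_div_times less_le_trans mult.commute add.commute zero_less_one)
    \<comment> \<open>The larger parts make up at least half of the tiled vertices, so the required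
      inequality compares \<open>n / 8\<close> with about \<open>card R' / 2\<close>.\<close>
    also have "(s1 + s2) * ?q \<le> 2 * (s2 * ?q)" using s by (simp add: add_mult_distrib)
    finally have "card R' < 2 * (s2 * ?q) + (s1 + s2)" by simp
    moreover have "s1 * d2 + s2 * d2 = (s1 + s2) * d2" by (simp add: add_mult_distrib)
    ultimately show "s1 * d2 + s2 * d2 < s2 * ?q" using d2 cR' K by linarith
  qed (use s in simp)
  then obtain X4 where X4: "X4 \<subseteq> R'" "card R' < card X4 + (s1 + s2)" "tileable (W1 \<union> W2) EB E X4" by blast
  define Y where "Y = J \<union> (L1 \<union> L2) \<union> Z"
  have R'Y: "R' \<inter> Y = {}" using RJ by (auto simp: R'_def Y_def)
  have X1L1: "X1 \<inter> L1 = {}" using X1(1) by (auto simp: M1_def P1_def)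
  have X1I: "X1 \<inter> I = {}" using X1(1) disj by (auto simp: M1_def P1_def)
  have ZP2: "Z \<subseteq> P2" using Z(1) by (auto simp: R_def)
  have X1Y: "X1 \<inter> Y = {}" using X1L1 X1I subs L2P2 ZP2 unfolding Y_def J_def by blast
  have R'P2: "R' \<subseteq> P2" by (auto simp: R'_def R_def)
  have tile: "tileable (W1 \<union> W2) EB E (X1 \<union> (Y \<union> X4))"
  proof (rule tileable_Un[OF X1(2)])
    show "tileable (W1 \<union> W2) EB E (Y \<union> X4)"
      using Z(3) X4 R'Y unfolding Y_def[symmetric] by (intro tileable_Un) blast+
    show "X1 \<inter> (Y \<union> X4) = {}" using X1Y X4(1) R'P2 subs(6) by blast
  qed
  have Ysub: "Y \<subseteq> I \<union> M \<union> P" using L1sub L2P2 ZP2 subs unfolding Y_def J_def by blast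
  have Xsub: "X1 \<union> (Y \<union> X4) \<subseteq> I \<union> M \<union> P"
    using Ysub X1(1) X4(1) R'P2 subs(2) by (auto simp: M1_def P1_def)
  have "I \<union> M \<union> P \<subseteq> X1 \<union> (Y \<union> X4) \<union> (R' - X4)"
    by (auto simp: Y_def J_def R'_def R_def M2_def P2_def M1_def P1_def)
  then have "card (I \<union> M \<union> P) \<le> card (X1 \<union> (Y \<union> X4) \<union> (R' - X4))"
    using Xsub finI finM finP finR' by (intro card_mono) (auto intro: finite_subset)
  also have "\<dots> \<le> card (X1 \<union> (Y \<union> X4)) + card (R' - X4)" by (rule card_Un_le)
  also have "card (R' - X4) = card R' - card X4"
    using X4(1) finR' by (intro card_Diff_subset) (auto intro: finite_subset)
  also have "\<dots> < s1 + s2" using X4(2) s by linarith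
  finally show ?thesis using tile Xsub by (intro exI[of _ "X1 \<union> (Y \<union> X4)"]) simp
qed

section \<open>Averaging and maximal packings\<close>

text \<open>Markov's inequality with denominators cleared.\<close>

lemma card_mult_le_sum:
  fixes f :: "'a \<Rightarrow> nat"
  assumes "finite V" "T \<subseteq> V" "\<And>v. v \<in> T \<Longrightarrow> c \<le> k * f v"
  shows "card T * c \<le> k * (\<Sum>v\<in>V. f v)"
proof -
  have "card T * c = (\<Sum>v\<in>T. c)" by simp
  also have "\<dots> \<le> (\<Sum>v\<in>T. k * f v)" using assms(3) by (rule sum_mono)
  also have "\<dots> \<le> (\<Sum>v\<in>V. k * f v)" using assms by (intro sum_mono2) auto
  finally show ?thesis by (simp add: sum_distrib_left)
qed

lemma double_choose_two: "2 * (k choose 2) = k * (k - 1)"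
  by (cases k) (simp_all add: choose_two)

lemma maximal_star_packing:
  assumes fin: "finite V" and LV: "L \<subseteq> V"
  obtains I S where "I \<subseteq> L"
    "\<And>i. i \<in> I \<Longrightarrow> S i \<subseteq> V - L \<and> card (S i) = k \<and> (\<forall>a\<in>S i. {a, i} \<in> E)"
    "disjoint_family_on S I"
    "\<And>v. v \<in> L - I \<Longrightarrow> card {w\<in>V - L - (\<Union>i\<in>I. S i). {v, w} \<in> E} < k"
proof -
  define ok where "ok I S \<longleftrightarrow> I \<subseteq> L
    \<and> (\<forall>i\<in>I. S i \<subseteq> V - L \<and> card (S i) = k \<and> (\<forall>a\<in>S i. {a, i} \<in> E)) \<and> disjoint_family_on S I" for I S
  have finL: "finite L" using fin LV finite_subset by blast
  have "\<exists>S. ok {} S" by (simp add: ok_def disjoint_family_on_def)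
  moreover have "card I < card L + 1" if "\<exists>S. ok I S" for I
    using that card_mono[OF finL, of I] by (auto simp: ok_def)
  ultimately obtain I where "\<exists>S. ok I S" and max: "\<And>J. \<exists>S. ok J S \<Longrightarrow> card J \<le> card I"
    using ex_has_greatest_nat[of "\<lambda>I. \<exists>S. ok I S" "{}" card "card L + 1"] by auto
  then obtain S where ok: "ok I S" by blast
  have "card {w\<in>V - L - (\<Union>i\<in>I. S i). {v, w} \<in> E} < k" if v: "v \<in> L - I" for v
  proof (rule ccontr)
    assume "\<not> ?thesis"
    then obtain B where B: "B \<subseteq> {w\<in>V - L - (\<Union>i\<in>I. S i). {v, w} \<in> E}" "card B = k"
      using obtain_subset_with_card_n[of k "{w\<in>V - L - (\<Union>i\<in>I. S i). {v, w} \<in> E}"] by auto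
    have "ok (insert v I) (S(v := B))"
      unfolding ok_def
    proof (intro conjI ballI)
      show "insert v I \<subseteq> L" using v ok by (auto simp: ok_def)
      show "disjoint_family_on (S(v := B)) (insert v I)"
        unfolding disjoint_family_on_def
      proof (intro ballI impI)
        fix i j assume ij: "i \<in> insert v I" "j \<in> insert v I" "i \<noteq> j"
        have BS: "B \<inter> S i = {}" if "i \<in> I" for i using B(1) that by blast
        have "S i \<inter> S j = {}" if "i \<in> I" "j \<in> I" using ok ij(3) that by (simp add: ok_def disjoint_family_on_def)
        then show "(S(v := B)) i \<inter> (S(v := B)) j = {}"
          using ij v BS[of i] BS[of j] by (cases "i = v"; cases "j = v") (auto simp: Int_commute)
      qed
      fix i assume i: "i \<in> insert v I"
      show "(S(v := B)) i \<subseteq> V - L" using i ok B(1) by (cases "i = v") (auto simp: ok_def)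
      show "card ((S(v := B)) i) = k" using i ok B(2) by (cases "i = v") (auto simp: ok_def)
      have "{a, v} = {v, a}" for a by auto
      then show "{a, i} \<in> E" if "a \<in> (S(v := B)) i" for a
        using i ok B(1) that by (cases "i = v") (auto simp: ok_def)
    qed
    then have "card (insert v I) \<le> card I" using max by blast
    moreover have "finite I" using ok finL finite_subset by (auto simp: ok_def)
    ultimately show False using v by simp
  qed
  then show thesis using that[of I S] ok by (simp add: ok_def)
qed

text \<open>Take a tileable subset of \<open>L\<close> of greatest size. A copy in the rest could be
  added, and it would enlarge the set because a copy is non-empty.\<close>

lemma maximal_tileable_subset:
  assumes "finite L" "finite VF" "VF \<noteq> {}"
  obtains C where "C \<subseteq> L" "tileable VF EF E C"
    "\<not> has_disjoint_copies 1 VF EF (L - C) {e\<in>E. e \<subseteq> L - C}"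
proof -
  define ok where "ok C \<longleftrightarrow> C \<subseteq> L \<and> tileable VF EF E C" for C
  have "ok {}" by (simp add: ok_def tileable_empty)
  moreover have "card C < card L + 1" if "ok C" for C
    using that card_mono[OF assms(1), of C] by (auto simp: ok_def)
  ultimately obtain C where ok: "ok C" and max: "\<And>D. ok D \<Longrightarrow> card D \<le> card C"
    using ex_has_greatest_nat[of ok "{}" card "card L + 1"] by auto
  have "\<not> has_disjoint_copies 1 VF EF (L - C) {e\<in>E. e \<subseteq> L - C}"
  proof
    assume "has_disjoint_copies 1 VF EF (L - C) {e\<in>E. e \<subseteq> L - C}"
    then obtain f where f: "embeds f VF EF (L - C) {e\<in>E. e \<subseteq> L - C}"
      unfolding has_disjoint_copies_1_iff by blast
    then have f': "embeds f VF EF UNIV E" "f ` VF \<subseteq> L - C" by (auto simp: embeds_def)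
    then have "ok (f ` VF \<union> C)"
      using ok unfolding ok_def by (intro conjI tileable_copy) auto
    then have "card (f ` VF \<union> C) \<le> card C" by (rule max)
    moreover have "finite C" using ok assms(1) finite_subset by (auto simp: ok_def)
    ultimately have "f ` VF \<union> C = C"
      using assms(2) by (intro card_seteq[symmetric]) auto
    then show False using f'(2) assms(3) by blast
  qed
  then show thesis using that[of C] ok by (simp add: ok_def)
qed

subsection \<open>The edge bound\<close>

text \<open>The number \<open>m\<close> is the least possible size of the uncovered set
  \<open>U\<close>: the other vertices form at most \<open>t\<close> copies and fewer than
  \<open>s1 + s2\<close> leftovers. It is introduced by an equation between sums to avoid truncated
  subtraction.\<close>

lemma card_edges_no_disjoint_copies:
  fixes V :: "'a set" and EB :: "'b set set"
  assumes bip: "bipartite_graph s1 s2 W1 W2 EB" and s: "2 \<le> s1" "s1 \<le> s2"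
    and fin: "finite V" and n: "card V = n" "100 * (s1 + s2)\<^sup>2 \<le> n"
    and sg: "simple_graph V E" and free: "\<not> has_disjoint_copies (t + 1) (W1 \<union> W2) EB V E"
    and m: "n + 1 = m + (s1 + s2) * (t + 1)" "65 * (s1 * (s1 + s2) * m) \<le> n"
  shows "card E \<le> (n - m choose 2) + ex m (W1 \<union> W2) EB + s1 * (s1 + s2) * n"
proof (rule ccontr)
  assume contra: "\<not> ?thesis"
  then have big: "(n - m choose 2) + s1 * (s1 + s2) * n < card E" by simp
  define s where "s = s1 + s2"
  have VF: "finite (W1 \<union> W2)" "card (W1 \<union> W2) = s"
    using bip by (auto simp: bipartite_graph_def s_def card_Un_disjoint)
  have VF0: "W1 \<union> W2 \<noteq> {}" using VF s by (auto simp: s_def)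
  let ?D = "\<lambda>v. card (nonnbrs V E v)"
  have s2s: "2 * s1 \<le> s" using s by (simp add: s_def)
  have "s \<le> s\<^sup>2" using s by (simp add: s_def power2_eq_square)
  then have sn: "100 * s \<le> n" using n(2) by (simp add: s_def)
  have npos: "0 < n" using sn s by (simp add: s_def)
  have m': "65 * (s1 * (s * m)) \<le> n" using m(2) by (simp add: s_def mult.assoc)
  have mn: "m \<le> n" using m(1) s by (simp add: algebra_simps)

  \<comment> \<open>Density of a graph that violates the bound\<close>
  have sumD: "(\<Sum>v\<in>V. ?D v) \<le> 2 * m * n"
  proof -
    define k where "k = n - m"
    have nk: "n = k + m" using mn by (simp add: k_def)
    \<comment> \<open>The term \<open>s1 * s * n\<close> absorbs the linear loss \<open>k\<close>,
      so twice the number of edges is at least \<open>k * k\<close>. The non-neighbours then sum to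
      at most \<open>n * n - k * k = 2 * k * m + m * m\<close>, which is at most
      \<open>2 * m * n\<close>.\<close>
    have "k * (k - 1) + 2 * (s1 * s * n) \<le> 2 * card E"
      using big double_choose_two[of k] by (simp add: k_def s_def)
    moreover have "k * k \<le> k * (k - 1) + k" by (cases k) simp_all
    moreover have "n \<le> s1 * s * n" using s by (simp add: s_def)
    moreover have "k \<le> n" by (simp add: k_def)
    moreover have "n * n = k * k + 2 * (k * m) + m * m" "2 * m * n = 2 * (k * m) + 2 * (m * m)"
      by (simp_all add: nk algebra_simps)
    ultimately show ?thesis using sum_nonnbrs[OF fin sg, unfolded n(1)] by linarith
  qed
  have markov: "card T \<le> 2 * k * m" if "T \<subseteq> V" "\<And>v. v \<in> T \<Longrightarrow> n \<le> k * ?D v" for T k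
  proof -
    have "card T * n \<le> k * (\<Sum>v\<in>V. ?D v)" by (rule card_mult_le_sum[OF fin that])
    also have "\<dots> \<le> k * (2 * m * n)" using sumD by (rule mult_le_mono2)
    finally have "card T * n \<le> (2 * k * m) * n" by (simp add: mult_ac)
    then show ?thesis using npos by simp
  qed

  \<comment> \<open>Vertices with many, medium and few non-neighbours\<close>
  \<comment> \<open>Any \<open>s1\<close> vertices outside \<open>L\<close> jointly miss at most
    \<open>n / 4\<close> vertices, which leaves room for common neighbours. The stricter threshold
    for \<open>P\<close> makes the \<open>s1 * d + s2 * d\<close> of the matching argument at most
    \<open>n / 8\<close>.\<close>
  define L where "L = {v\<in>V. n < 4 * s1 * ?D v}"
  define P where "P = {v\<in>V. 8 * s * ?D v \<le> n}"
  define M where "M = V - L - P"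
  have LV: "L \<subseteq> V" by (auto simp: L_def)
  have finL: "finite L" using LV fin finite_subset by blast
  have LP: "L \<inter> P = {}"
  proof -
    have "v \<notin> P" if "v \<in> L" for v
    proof -
      have "4 * s1 * ?D v \<le> 8 * s * ?D v" using s2s by (intro mult_le_mono1) simp
      moreover have "n < 4 * s1 * ?D v" using that unfolding L_def by blast
      ultimately have "\<not> 8 * s * ?D v \<le> n" by linarith
      then show ?thesis unfolding P_def by blast
    qed
    then show ?thesis by blast
  qed
  have "card L \<le> 2 * (4 * s1) * m" by (rule markov) (auto simp: L_def)
  then have "s * card L \<le> s * (2 * (4 * s1) * m)" by (rule mult_le_mono2)
  also have "\<dots> = 8 * (s1 * (s * m))" by simp
  finally have cL: "65 * (s * card L) \<le> 8 * n" using m' by linarith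
  have "card (V - P) \<le> 2 * (8 * s) * m" by (rule markov) (auto simp: P_def)
  \<comment> \<open>Here \<open>s1 \<ge> 2\<close> turns the bound \<open>16 * s * m\<close> into
    \<open>8 * s1 * s * m\<close>, which is at most \<open>8 * n / 65\<close>.\<close>
  moreover have "2 * (s * m) \<le> s1 * (s * m)" using s by (intro mult_le_mono1)
  ultimately have cVP: "65 * card (V - P) \<le> 8 * n" using m' unfolding mult.assoc by linarith
  have "card M \<le> card (V - P)" using fin by (intro card_mono) (auto simp: M_def)
  then have cM: "65 * card M \<le> 8 * n" using cVP by linarith
  have "card (V - P) = n - card P" using fin n(1) by (subst card_Diff_subset) (auto simp: P_def)
  then have cP: "57 * n \<le> 65 * card P" using cVP by linarith

  \<comment> \<open>Packings inside \<open>L\<close> and the uncovered set \<open>U\<close>\<close>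
  obtain I S where I: "I \<subseteq> L"
      and S: "\<And>i. i \<in> I \<Longrightarrow> S i \<subseteq> V - L \<and> card (S i) = s1 \<and> (\<forall>a\<in>S i. {a, i} \<in> E)"
      and disjS: "disjoint_family_on S I"
      and few: "\<And>v. v \<in> L - I \<Longrightarrow> card {w\<in>V - L - (\<Union>i\<in>I. S i). {v, w} \<in> E} < s1"
    using maximal_star_packing[OF fin LV, of s1 E] by blast
  have finI: "finite I" using I finL finite_subset by blast
  obtain C where C: "C \<subseteq> L - I" "tileable (W1 \<union> W2) EB E C"
      and freeU: "\<not> has_disjoint_copies 1 (W1 \<union> W2) EB (L - I - C) {e\<in>E. e \<subseteq> L - I - C}"
    using maximal_tileable_subset[of "L - I" "W1 \<union> W2" EB E] finL VF VF0 by blast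
  have finC: "finite C" using C(1) finL finite_subset by blast
  define U where "U = L - I - C"
  have UV: "U \<subseteq> V" using LV by (auto simp: U_def)
  have finU: "finite U" using finL by (simp add: U_def)
  have cI: "card I \<le> card L" using I finL by (rule card_mono[rotated])

  have "\<exists>X\<subseteq>I \<union> M \<union> P. tileable (W1 \<union> W2) EB E X \<and> card (I \<union> M \<union> P) < card X + (s1 + s2)"
  proof (rule tileable_almost_all[OF bip _ s(2) fin n _ _ _ _ _ _ _ disjS])
    show "S i \<subseteq> M \<union> P \<and> card (S i) = s1 \<and> (\<forall>a\<in>S i. {a, i} \<in> E)" if "i \<in> I" for i
      using S[OF that] by (auto simp: M_def)
    show "4 * s1 * ?D v \<le> n" if "v \<in> M \<union> P" for v
      using that LP by (auto simp: M_def L_def P_def)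
    show "8 * (s1 + s2) * ?D v \<le> n" if "v \<in> P" for v using that by (simp add: P_def s_def)
    have "s * card I \<le> s * card L" using cI by (rule mult_le_mono2)
    then show "65 * (s1 + s2) * card I \<le> 8 * n" using cL unfolding s_def mult.assoc by linarith
  qed (use s I LV LP cM cP in \<open>auto simp: M_def P_def\<close>)
  then obtain X where X: "X \<subseteq> I \<union> M \<union> P" "tileable (W1 \<union> W2) EB E X"
      "card (I \<union> M \<union> P) < card X + s" unfolding s_def by blast
  have finX: "finite X" using X(2) VF(1) by (rule tileable_finite)
  have split: "V = U \<union> C \<union> (I \<union> M \<union> P)" "C \<inter> (I \<union> M \<union> P) = {}"
    using C(1) I LV LP by (auto simp: U_def M_def P_def)
  have XC: "X \<inter> C = {}" using X(1) split(2) by blast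
  \<comment> \<open>This tiling has at most \<open>t\<close> copies and misses, apart from
    \<open>U\<close>, fewer than \<open>s\<close> vertices; comparing sizes gives
    \<open>m \<le> card U\<close>.\<close>
  have "tileable (W1 \<union> W2) EB E (X \<union> C)" using X(2) C(2) XC by (rule tileable_Un)
  then obtain k where k: "card (X \<union> C) = k * s" "has_disjoint_copies k (W1 \<union> W2) EB (X \<union> C) E"
    using tileable_has_disjoint_copies VF by blast
  have "X \<union> C \<subseteq> V" using X(1) split(1) by blast
  then have "\<not> t + 1 \<le> k" using has_disjoint_copies_mono[OF k(2)] free by blast
  then have "k * s \<le> t * s" by (intro mult_le_mono1) linarith
  then have "card X + card C \<le> t * s" using k(1) card_Un_disjoint[OF finX finC XC] by linarith
  moreover have "n \<le> card U + card C + card (I \<union> M \<union> P)"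
    using card_Un_le[of "U \<union> C" "I \<union> M \<union> P"] card_Un_le[of U C] split(1) n(1) by simp
  ultimately have "n < card U + t * s + s" using X(3) by linarith
  then have mu: "m \<le> card U" using m(1) by (simp add: s_def[symmetric] algebra_simps)

  define L1 where "L1 = (\<Union>i\<in>I. S i)"
  have "card L1 \<le> (\<Sum>i\<in>I. card (S i))" unfolding L1_def by (rule card_UN_le[OF finI])
  also have "\<dots> = s1 * card I" using S by simp
  finally have cL1: "card L1 \<le> s1 * card I" .
  have "L1 \<subseteq> V" using S unfolding L1_def by blast
  then have finL1: "finite L1" using fin by (rule finite_subset)
  let ?F = "\<lambda>v. {w\<in>V - L - L1. {v, w} \<in> E}"
  have few': "card (?F v) \<le> s1" if "v \<in> U" for v
    using few[of v] that by (auto simp: U_def L1_def)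
  have finF: "finite (?F v)" for v using fin by simp

  \<comment> \<open>The neighbours of a vertex of \<open>U\<close> lie in \<open>L\<close>, among
    the leaves, or among fewer than \<open>s1\<close> others, so there are fewer than
    \<open>n / 2\<close> of them. Markov's inequality then improves
    \<open>card L \<le> 8 * s1 * m\<close> to a bound for \<open>U\<close> without the factor
    \<open>s1\<close>.\<close>
  have u4: "card U \<le> 2 * 2 * m"
  proof (rule markov[OF UV])
    fix v assume v: "v \<in> U"
    have "card {w\<in>V. {v, w} \<in> E} \<le> card (L \<union> L1 \<union> ?F v)"
      using finL finL1 finF by (intro card_mono) auto
    also have "\<dots> \<le> card L + card L1 + card (?F v)"
      using card_Un_le[of "L \<union> L1" "?F v"] card_Un_le[of L L1] by linarith
    also have "card L1 \<le> s1 * card L" using cL1 mult_le_mono2[OF cI, of s1] by linarith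
    finally have "card {w\<in>V. {v, w} \<in> E} \<le> card L + s1 * card L + s1" using few'[OF v] by linarith
    moreover have "2 * (s1 * card L) \<le> s * card L" "4 * card L \<le> s * card L"
      using s mult_le_mono1[OF s2s, of "card L"] by (simp_all add: s_def)
    ultimately show "n \<le> 2 * ?D v"
      using card_nbrs_plus_nonnbrs[OF fin, of v E] n(1) cL sn s2s by linarith
  qed

  \<comment> \<open>Counting the edges\<close>
  define u where "u = card U"
  define Q where "Q = I \<union> C"
  have cQ: "card Q = card I + card C" using finI finC C(1) unfolding Q_def by (intro card_Un_disjoint) auto
  \<comment> \<open>Each vertex of \<open>Q\<close> accounts for at most \<open>s1 + 1\<close>
    possible neighbours of a vertex of \<open>U\<close>: itself and, if it is a centre, its leaves.
    The surplus of non-neighbours is chosen as \<open>2 * u * (s1 + 1)\<close> so that the two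
    contributions of \<open>Q\<close> cancel exactly.\<close>
  have "2 * card E + card Q * (2 * u * (s1 + 1))
    \<le> 2 * card {e\<in>E. e \<subseteq> U} + 2 * (card U * ((s1 + 1) * card Q + s1)) + (card V - card U) * (card V - card U - 1)"
  proof (rule card_split_edges[OF fin sg UV])
    show "Q \<subseteq> V - U" using I C(1) LV by (auto simp: Q_def U_def)
    fix v
    show "card {w\<in>V - U. {v, w} \<in> E} \<le> (s1 + 1) * card Q + s1" if v: "v \<in> U"
    proof -
      have "card {w\<in>V - U. {v, w} \<in> E} \<le> card (Q \<union> L1 \<union> ?F v)"
        using finI finC finL1 finF by (intro card_mono) (auto simp: Q_def U_def)
      also have "\<dots> \<le> card Q + card L1 + card (?F v)"
        using card_Un_le[of "Q \<union> L1" "?F v"] card_Un_le[of Q L1] by linarith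
      also have "card L1 \<le> s1 * card Q" using cL1 cQ by (simp add: add_mult_distrib2)
      finally show ?thesis using few'[OF v] by (simp add: add_mult_distrib)
    qed
    \<comment> \<open>A vertex of \<open>Q\<close> lies in \<open>L\<close> and has more than
      \<open>n / (4 * s1)\<close> non-neighbours. Multiplied by \<open>4 * s1\<close>, the left side
      is at most \<open>28 * s1 * s * m + 4 * s1\<close> by \<open>u \<le> 4 * m\<close> and
      \<open>2 \<le> s1\<close>, hence less than \<open>n\<close>.\<close>
    show "card U + 1 + 2 * u * (s1 + 1) \<le> ?D v" if v: "v \<in> Q"
    proof -
      have "v \<in> L" using v I C(1) by (auto simp: Q_def)
      then have D: "n < 4 * s1 * ?D v" by (simp add: L_def)
      have u7: "2 * (u + 2 * u * (s1 + 1)) \<le> 7 * (s1 * u)"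
      proof -
        have "2 * u \<le> s1 * u" using s by simp
        moreover have "2 * (u + 2 * u * (s1 + 1)) = 6 * u + 4 * (s1 * u)" by (simp add: algebra_simps)
        ultimately show ?thesis by linarith
      qed
      have "s1 * u \<le> 4 * (s1 * m)" using u4 by (simp add: u_def)
      then have "2 * (u + 2 * u * (s1 + 1)) \<le> 28 * (s1 * m)" using u7 by linarith
      then have "2 * s1 * (2 * (u + 2 * u * (s1 + 1))) \<le> 2 * s1 * (28 * (s1 * m))"
        by (rule mult_le_mono2)
      also have "\<dots> = 28 * (s1 * (2 * s1 * m))" by simp
      also have "s1 * (2 * s1 * m) \<le> s1 * (s * m)" using s2s by (intro mult_le_mono2 mult_le_mono1)
      finally have "2 * s1 * (2 * (u + 2 * u * (s1 + 1))) + 4 * s1 \<le> n" using m' sn s2s by linarith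
      moreover have "4 * s1 * (card U + 1 + 2 * u * (s1 + 1)) = 2 * s1 * (2 * (u + 2 * u * (s1 + 1))) + 4 * s1"
        by (simp add: u_def algebra_simps)
      ultimately have "4 * s1 * (card U + 1 + 2 * u * (s1 + 1)) < 4 * s1 * ?D v" using D by linarith
      then show ?thesis by (meson less_imp_le_nat mult_le_mono2 not_le)
    qed
  qed
  moreover have "2 * (card U * ((s1 + 1) * card Q + s1)) = card Q * (2 * u * (s1 + 1)) + 2 * (u * s1)"
    by (simp add: u_def algebra_simps)
  ultimately have "2 * card E \<le> 2 * card {e\<in>E. e \<subseteq> U} + 2 * (u * s1) + (n - u) * (n - u - 1)"
    unfolding n(1) u_def[symmetric] by linarith
  moreover have "card {e\<in>E. e \<subseteq> U} \<le> ex u (W1 \<union> W2) EB"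
    unfolding u_def using freeU sg
    by (intro card_le_ex[OF finU]) (auto simp: U_def simple_graph_def)
  moreover have "2 * (n - u choose 2) = (n - u) * (n - u - 1)" by (rule double_choose_two)
  ultimately have "card E \<le> ex u (W1 \<union> W2) EB + (n - u choose 2) + u * s1" by linarith
  moreover have "ex u (W1 \<union> W2) EB + (n - u choose 2) \<le> ex m (W1 \<union> W2) EB + (n - m choose 2)"
  proof (rule ex_plus_choose_antimono)
    show "m \<le> u" using mu by (simp add: u_def)
    have "m \<le> s1 * (s * m)" using s by (simp add: s_def)
    then show "2 * u \<le> n" using u4 m' unfolding u_def by linarith
  qed
  moreover have "u * s1 \<le> s1 * (s1 + s2) * n"
  proof -
    have "u \<le> n" using card_mono[OF fin UV] n(1) by (simp add: u_def)
    moreover have "n \<le> (s1 + s2) * n" using s by simp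
    ultimately have "s1 * u \<le> s1 * ((s1 + s2) * n)" by (intro mult_le_mono2) linarith
    then show ?thesis by (simp add: mult_ac)
  qed
  ultimately show False using contra by linarith
qed

section \<open>From the real bounds on \<open>t\<close> to the edge bound\<close>

theorem theorem1p16:
  fixes s1 s2 :: nat and W1 W2 :: "'b set" and EB :: "'b set set"
  assumes "2 \<le> s1" and "s1 \<le> s2"
    and "bipartite_graph s1 s2 W1 W2 EB"
  shows "\<exists>n0::nat. \<forall>n\<ge>n0. \<forall>t::nat.
     real n / real (s1 + s2) - real n / (65 * real s1 * real (s1 + s2) ^ 2) \<le> real t \<and>
     real t \<le> real n / real (s1 + s2) \<longrightarrow>
     ex_copies n (t + 1) (W1 \<union> W2) EB
       \<le> ((s1 + s2) * (t + 1) - 1 choose 2)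
         + ex (nat (int n - int ((s1 + s2) * (t + 1)) + 1)) (W1 \<union> W2) EB
         + s1 * (s1 + s2) * n"
proof (intro exI[of _ "100 * (s1 + s2)\<^sup>2"] allI impI, elim conjE)
  fix n t :: nat
  assume n: "100 * (s1 + s2)\<^sup>2 \<le> n"
    and t: "real n / real (s1 + s2) - real n / (65 * real s1 * real (s1 + s2) ^ 2) \<le> real t"
  let ?s = "s1 + s2"
  show "ex_copies n (t + 1) (W1 \<union> W2) EB \<le> (?s * (t + 1) - 1 choose 2)
         + ex (nat (int n - int (?s * (t + 1)) + 1)) (W1 \<union> W2) EB + s1 * ?s * n"
  proof (rule ex_copies_leI)
    fix E assume sg: "simple_graph {0..<n} E" and free: "\<not> has_disjoint_copies (t + 1) (W1 \<union> W2) EB {0..<n} E"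
    show "card E \<le> (?s * (t + 1) - 1 choose 2)
         + ex (nat (int n - int (?s * (t + 1)) + 1)) (W1 \<union> W2) EB + s1 * ?s * n"
    \<comment> \<open>For \<open>t\<close> close to \<open>n / ?s\<close> there may be too few
      vertices for \<open>t + 1\<close> copies. Then \<open>nat\<close> truncates the argument of
      \<open>ex\<close> to 0, and the first binomial alone bounds the number of all pairs.\<close>
    proof (cases "n < ?s * (t + 1)")
      case True
      have "E \<subseteq> {e. e \<subseteq> {0..<n} \<and> card e = 2}" using sg by (auto simp: simple_graph_def)
      then have "card E \<le> card {e. e \<subseteq> {0..<n} \<and> card e = 2}" by (intro card_mono) auto
      also have "\<dots> = (n choose 2)" by (simp add: n_subsets)
      also have "\<dots> \<le> (?s * (t + 1) - 1 choose 2)" using True by (intro binomial_right_mono) linarith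
      finally show ?thesis by simp
    next
      case False
      define m where "m = n + 1 - ?s * (t + 1)"
      have m: "n + 1 = m + ?s * (t + 1)" using False by (simp add: m_def)
      \<comment> \<open>The lower bound on \<open>t\<close> multiplied by
        \<open>65 * s1 * ?s\<^sup>2\<close>, that is,
        \<open>65 * s1 * ?s * (n - ?s * t) \<le> n\<close>. Since \<open>m \<le> n - ?s * t\<close>,
        it yields the smallness condition on \<open>m\<close>.\<close>
      have "real n * (65 * real s1 * real ?s) \<le> real n + 65 * real s1 * real ?s * (real ?s * real t)"
      proof -
        define a where "a = 65 * real s1"
        define b where "b = real ?s"
        have ab: "0 < a" "0 < b" using assms(1) by (simp_all add: a_def b_def)
        have "real n / b \<le> real t + real n / (a * b\<^sup>2)" using t unfolding a_def b_def by linarith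
        then have "(a * b\<^sup>2) * (real n / b) \<le> (a * b\<^sup>2) * (real t + real n / (a * b\<^sup>2))"
          using ab by (intro mult_left_mono) simp_all
        moreover have "(a * b\<^sup>2) * (real n / b) = real n * (a * b)"
          using ab by (simp add: power2_eq_square)
        moreover have "(a * b\<^sup>2) * (real t + real n / (a * b\<^sup>2)) = real n + a * b * (b * real t)"
          using ab by (simp add: power2_eq_square distrib_left)
        ultimately show ?thesis unfolding a_def b_def by linarith
      qed
      then have "real (n * (65 * s1 * ?s)) \<le> real (n + 65 * s1 * ?s * (?s * t))" by simp
      then have nt: "n * (65 * s1 * ?s) \<le> n + 65 * s1 * ?s * (?s * t)" by (simp only: of_nat_le_iff)
      have "m + ?s * t \<le> n" using m assms(1) by (simp add: algebra_simps)
      then have "(65 * s1 * ?s) * (m + ?s * t) \<le> (65 * s1 * ?s) * n" by (rule mult_le_mono2)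
      then have "65 * (s1 * ?s * m) \<le> n" using nt by (simp add: algebra_simps)
      then have "card E \<le> (n - m choose 2) + ex m (W1 \<union> W2) EB + s1 * ?s * n"
        using assms n sg free m by (intro card_edges_no_disjoint_copies[where V = "{0..<n}"]) auto
      moreover have "n - m = ?s * (t + 1) - 1" using m by linarith
      moreover have "nat (int n - int (?s * (t + 1)) + 1) = m" using m by linarith
      ultimately show ?thesis by simp
    qed
  qed
qed

end
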